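(* Let $u^k_{l,h}\in V_h$ be the approximate solution of the central difference scheme for linearized peridynamics: for $k\ge1$ and all $\tilde u\in V_h$, $$\Big(\frac{u^{k+1}_{l,h}-2u^k_{l,h}+u^{k-1}_{l,h}}{\Delta t^2},\tilde u\Big)=(\mathcal L^\epsilon_l(u^k_{l,h}),\tilde u)+(b^k_h,\tilde u),$$ and, for $k=0$ and all $\tilde u\in V_h$, $$\Big(\frac{u^1_{l,h}-u^0_{l,h}}{\Delta t^2},\tilde u\Big)=\frac12(\mathcal L^\epsilon_l(u^0_{l,h}),\tilde u)+\frac1{\Delta t}(v^0_{l,h},\tilde u)+\frac12(b^0_h,\tilde u).$$ In the absence of body force, $b(t)=0$ for all $t$, if $\Delta t$ satisfies the CFL-like condition $$\frac{\Delta t^2}{4}\sup_{u\in V_h\setminus\{0\}}\frac{a^\epsilon_l(u,u)}{(u,u)}\le1,$$ then the discrete energy $\mathcal E(u^k_{l,h})$ is positive (i.e. $\mathcal E(u^k_{l,h})\ge0$) and we have the stability $$\mathcal E(u^k_{l,h})=\mathcal E(u^0_{l,h})$$ for all time steps $k$.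
   Context: Let $d\in\{2,3\}$ and let $D\subset\mathbb R^d$ (the material domain) be an open set with $C^1$ boundary. $\epsilon>0$ is the horizon, $H_\epsilon(x)=\{y\in\mathbb R^d:|y-x|<\epsilon\}$, $\omega_d$ is the volume of the unit ball. The density is $\rho=1$. $(\cdot,\cdot)$, $\|\cdot\|$ are the $L^2(D;\mathbb R^d)$ inner product and norm. $V_h\subset H^1_0(D;\mathbb R^d)$ is the space of continuous piecewise linear functions on a conforming, shape regular mesh of triangles/tetrahedra of size $h$; functions are extended by zero outside $D$. $\Delta t>0$ is the time step; $b^k_h$ is the $L^2$ projection onto $V_h$ of the body force $b(k\Delta t)$; $u^0_{l,h},v^0_{l,h}\in V_h$ are the discrete initial data (the $L^2$ projections of the initial displacement and velocity). Influence function: $J^\epsilon(r)=J(r/\epsilon)$, $0\le J(r)\le M$ for $r<1$, $J(r)=0$ for $r\ge1$. Boundary function: $\omega:D\to[0,1]$ equals $1$ in the interior and decays smoothly to $0$ at $\partial D$, with bounded first and second derivatives, extended by zero outside $D$. Strains: with $e_{y-x}=\frac{y-x}{|y-x|}$, $S(y,x;u)=\frac{u(y)-u(x)}{|y-x|}\cdot e_{y-x}$ and $\theta(x;u)=\frac1{\epsilon^d\omega_d}\int_{H_\epsilon(x)}\omega(y)J^\epsilon(|y-x|)S(y,x;u)|y-x|\,dy$. The potentials $f$ and $g$ are four times differentiable, with a well at the origin and convex near it, so $f''(0)\ge0$ and $g''(0)\ge0$. Linearized force: $\mathcal L^\epsilon_l=\mathcal L^\epsilon_{T,l}+\mathcal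 L^\epsilon_{D,l}$, $$\mathcal L^\epsilon_{T,l}(u)(x)=\frac{2}{\epsilon^{d+1}\omega_d}\int_{H_\epsilon(x)}\omega(x)\omega(y)J^\epsilon(|y-x|)f''(0)S(y,x;u)e_{y-x}\,dy,$$ $$\mathcal L^\epsilon_{D,l}(u)(x)=\frac{g''(0)}{\epsilon^{d+2}\omega_d}\int_{H_\epsilon(x)}\omega(x)\omega(y)J^\epsilon(|y-x|)[\theta(y;u)+\theta(x;u)]e_{y-x}\,dy.$$ Bilinear form: $a^\epsilon_l=a^\epsilon_{T,l}+a^\epsilon_{D,l}$, which satisfies $(\mathcal L^\epsilon_l(u),v)=-a^\epsilon_l(u,v)$, with $$a^\epsilon_{T,l}(u,v)=\frac{f''(0)}{\epsilon^{d+1}\omega_d}\int_D\int_D\omega(x)\omega(y)J^\epsilon(|y-x|)|y-x|S(y,x;u)S(y,x;v)\,dy\,dx,$$ $$a^\epsilon_{D,l}(u,v)=\frac{g''(0)}{\epsilon^2}\int_D\omega(x)\theta(x;u)\theta(x;v)\,dx.$$ Discrete energy: with $\bar\partial^+_tu^k=\frac{u^{k+1}-u^k}{\Delta t}$ and $\overline u^{k+1}=\frac{u^{k+1}+u^k}2$, $$\mathcal E(u^k_{l,h})=\frac12\Big[\|\bar\partial^+_tu^k_{l,h}\|^2-\frac{\Delta t^2}4a^\epsilon_l(\bar\partial^+_tu^k_{l,h},\bar\partial^+_tu^k_{l,h})+a^\epsilon_l(\overline u^{k+1}_{l,h},\overline u^{k+1}_{l,h})\Big].$$ *)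

theory Defs
  imports "HOL-Analysis.Analysis"
begin

section \<open>Domain, boundary function, influence function, potentials\<close>

definition C1_fun :: "('a::real_normed_vector \<Rightarrow> real) \<Rightarrow> bool" where
  "C1_fun \<gamma> \<longleftrightarrow>
    (\<exists>\<gamma>' :: 'a \<Rightarrow> 'a \<Rightarrow>\<^sub>L real.
      (\<forall>x. (\<gamma> has_derivative blinfun_apply (\<gamma>' x)) (at x)) \<and> continuous_on UNIV \<gamma>')"

text \<open>Near each boundary point, \<open>D\<close> is the region above a \<open>C\<^sup>1\<close> graph over the hyperplane
  orthogonal to some unit vector \<open>\<nu>\<close>; only the values of \<open>\<gamma>\<close> on that hyperplane matter.\<close>

definition C1_boundary :: "'a::euclidean_space set \<Rightarrow> bool" where
  "C1_boundary D \<longleftrightarrow>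
    (\<forall>p \<in> frontier D. \<exists>r>0. \<exists>\<nu> \<gamma>. norm \<nu> = 1 \<and> C1_fun \<gamma> \<and>
      D \<inter> ball p r = {x \<in> ball p r. \<gamma> (x - (x \<bullet> \<nu>) *\<^sub>R \<nu>) < x \<bullet> \<nu>})"

text \<open>\<open>\<delta>\<close> is the width of the boundary layer in which \<open>\<omega>\<close> decays from 1 to 0. Decay to 0 at the
  boundary is expressed by continuity on the whole space of the extension by zero.\<close>

definition boundary_function ::
  "'a::euclidean_space set \<Rightarrow> real \<Rightarrow> ('a \<Rightarrow> real) \<Rightarrow> bool" where
  "boundary_function D \<delta> \<omega> \<longleftrightarrow>
    (\<forall>x. 0 \<le> \<omega> x \<and> \<omega> x \<le> 1) \<and>
    (\<forall>x. x \<notin> D \<longrightarrow> \<omega> x = 0) \<and>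
    (\<forall>x. ball x \<delta> \<subseteq> D \<longrightarrow> \<omega> x = 1) \<and>
    continuous_on UNIV \<omega> \<and>
    (\<exists>(\<omega>' :: 'a \<Rightarrow> 'a \<Rightarrow>\<^sub>L real) (\<omega>'' :: 'a \<Rightarrow> 'a \<Rightarrow>\<^sub>L ('a \<Rightarrow>\<^sub>L real)).
      (\<forall>x\<in>D. (\<omega> has_derivative blinfun_apply (\<omega>' x)) (at x)) \<and>
      (\<forall>x\<in>D. (\<omega>' has_derivative blinfun_apply (\<omega>'' x)) (at x)) \<and>
      bounded (\<omega>' ` D) \<and> bounded (\<omega>'' ` D))"

definition influence_function :: "real \<Rightarrow> (real \<Rightarrow> real) \<Rightarrow> bool" where
  "influence_function M J \<longleftrightarrow>
    set_borel_measurable borel {0..} J \<and>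
    (\<forall>r. 0 \<le> r \<and> r < 1 \<longrightarrow> 0 \<le> J r \<and> J r \<le> M) \<and>
    (\<forall>r\<ge>1. J r = 0)"

text \<open>Nonnegativity of the second derivative at the origin is a consequence of these conditions.\<close>

definition potential :: "(real \<Rightarrow> real) \<Rightarrow> bool" where
  "potential f \<longleftrightarrow>
    (\<forall>n<4. (deriv ^^ n) f differentiable_on UNIV) \<and>
    (\<exists>r>0. (\<forall>x \<in> ball 0 r. f 0 \<le> f x) \<and> convex_on (ball 0 r) f)"

section \<open>The space \<open>L\<^sup>2(D)\<close> and projections\<close>

definition in_L2 :: "'a::euclidean_space set \<Rightarrow> ('a \<Rightarrow> 'a) \<Rightarrow> bool" where
  "in_L2 D u \<longleftrightarrow>
    set_borel_measurable lborel D u \<and> set_integrable lborel D (\<lambda>x. (norm (u x))\<^sup>2)"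

definition L2_inner :: "'a::euclidean_space set \<Rightarrow> ('a \<Rightarrow> 'a) \<Rightarrow> ('a \<Rightarrow> 'a) \<Rightarrow> real" where
  "L2_inner D u v = (LINT x:D|lborel. u x \<bullet> v x)"

definition L2_norm :: "'a::euclidean_space set \<Rightarrow> ('a \<Rightarrow> 'a) \<Rightarrow> real" where
  "L2_norm D u = sqrt (L2_inner D u u)"

definition L2_projection ::
  "'a::euclidean_space set \<Rightarrow> ('a \<Rightarrow> 'a) set \<Rightarrow> ('a \<Rightarrow> 'a) \<Rightarrow> ('a \<Rightarrow> 'a) \<Rightarrow> bool" where
  "L2_projection D V w p \<longleftrightarrow> p \<in> V \<and> (\<forall>v\<in>V. L2_inner D p v = L2_inner D w v)"

section \<open>Finite element space\<close>

definition inradius :: "'a::euclidean_space set \<Rightarrow> real" where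
  "inradius K = Sup {r. 0 \<le> r \<and> (\<exists>x. cball x r \<subseteq> K)}"

text \<open>A conforming mesh of full-dimensional simplices, of size \<open>h\<close> and with shape regularity
  constant \<open>\<sigma>\<close>. Conformity is part of the library notion \<open>triangulation\<close>. A domain with curved
  boundary is not a finite union of simplices, so the elements are only required to lie in the
  closure of \<open>D\<close>.\<close>

definition fe_mesh :: "'a::euclidean_space set \<Rightarrow> real \<Rightarrow> real \<Rightarrow> 'a set set \<Rightarrow> bool" where
  "fe_mesh D h \<sigma> \<T> \<longleftrightarrow>
    triangulation \<T> \<and> \<T> \<noteq> {} \<and> \<Union>\<T> \<subseteq> closure D \<and>
    (\<forall>K\<in>\<T>. int DIM('a) simplex K) \<and>
    h = Max (diameter ` \<T>) \<and>
    (\<forall>K\<in>\<T>. diameter K \<le> \<sigma> * inradius K)"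

text \<open>Continuity on the whole space of the extension by zero encodes the zero trace, that is,
  the inclusion in \<open>H\<^sup>1\<^sub>0(D)\<close>.\<close>

definition fe_space :: "'a::euclidean_space set \<Rightarrow> 'a set set \<Rightarrow> ('a \<Rightarrow> 'a) set" where
  "fe_space D \<T> = {u. continuous_on UNIV u \<and>
    (\<forall>K\<in>\<T>. \<exists>A c. linear A \<and> (\<forall>x\<in>K. u x = A x + c)) \<and>
    (\<forall>x. x \<notin> D \<inter> \<Union>\<T> \<longrightarrow> u x = 0)}"

section \<open>Linearized peridynamics\<close>

definition vol_unit_ball :: "'a::euclidean_space itself \<Rightarrow> real" where
  "vol_unit_ball _ = measure lborel (ball (0::'a) 1)"

definition bond_dir :: "'a::euclidean_space \<Rightarrow> 'a \<Rightarrow> 'a" where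
  "bond_dir y x = (y - x) /\<^sub>R norm (y - x)"

definition bond_strain :: "('a::euclidean_space \<Rightarrow> 'a) \<Rightarrow> 'a \<Rightarrow> 'a \<Rightarrow> real" where
  "bond_strain u y x = ((u y - u x) /\<^sub>R norm (y - x)) \<bullet> bond_dir y x"

definition J_eps :: "real \<Rightarrow> (real \<Rightarrow> real) \<Rightarrow> real \<Rightarrow> real" where
  "J_eps \<epsilon> J r = J (r / \<epsilon>)"

definition hydro_strain ::
  "real \<Rightarrow> (real \<Rightarrow> real) \<Rightarrow> ('a::euclidean_space \<Rightarrow> real) \<Rightarrow> ('a \<Rightarrow> 'a) \<Rightarrow> 'a \<Rightarrow> real" where
  "hydro_strain \<epsilon> J \<omega> u x =
    1 / (\<epsilon> ^ DIM('a) * vol_unit_ball TYPE('a)) *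
    (LINT y:ball x \<epsilon>|lborel.
      \<omega> y * J_eps \<epsilon> J (norm (y - x)) * bond_strain u y x * norm (y - x))"

definition force_T ::
  "real \<Rightarrow> (real \<Rightarrow> real) \<Rightarrow> ('a::euclidean_space \<Rightarrow> real) \<Rightarrow> (real \<Rightarrow> real) \<Rightarrow>
    ('a \<Rightarrow> 'a) \<Rightarrow> 'a \<Rightarrow> 'a" where
  "force_T \<epsilon> J \<omega> f u x =
    (2 / (\<epsilon> ^ (DIM('a) + 1) * vol_unit_ball TYPE('a))) *\<^sub>R
    (LINT y:ball x \<epsilon>|lborel.
      (\<omega> x * \<omega> y * J_eps \<epsilon> J (norm (y - x)) * (deriv ^^ 2) f 0 * bond_strain u y x)
        *\<^sub>R bond_dir y x)"

definition force_D ::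
  "real \<Rightarrow> (real \<Rightarrow> real) \<Rightarrow> ('a::euclidean_space \<Rightarrow> real) \<Rightarrow> (real \<Rightarrow> real) \<Rightarrow>
    ('a \<Rightarrow> 'a) \<Rightarrow> 'a \<Rightarrow> 'a" where
  "force_D \<epsilon> J \<omega> g u x =
    ((deriv ^^ 2) g 0 / (\<epsilon> ^ (DIM('a) + 2) * vol_unit_ball TYPE('a))) *\<^sub>R
    (LINT y:ball x \<epsilon>|lborel.
      (\<omega> x * \<omega> y * J_eps \<epsilon> J (norm (y - x)) *
        (hydro_strain \<epsilon> J \<omega> u y + hydro_strain \<epsilon> J \<omega> u x)) *\<^sub>R bond_dir y x)"

definition force ::
  "real \<Rightarrow> (real \<Rightarrow> real) \<Rightarrow> ('a::euclidean_space \<Rightarrow> real) \<Rightarrow> (real \<Rightarrow> real) \<Rightarrow>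
    (real \<Rightarrow> real) \<Rightarrow> ('a \<Rightarrow> 'a) \<Rightarrow> 'a \<Rightarrow> 'a" where
  "force \<epsilon> J \<omega> f g u x = force_T \<epsilon> J \<omega> f u x + force_D \<epsilon> J \<omega> g u x"

definition bilin_T ::
  "'a::euclidean_space set \<Rightarrow> real \<Rightarrow> (real \<Rightarrow> real) \<Rightarrow> ('a \<Rightarrow> real) \<Rightarrow> (real \<Rightarrow> real) \<Rightarrow>
    ('a \<Rightarrow> 'a) \<Rightarrow> ('a \<Rightarrow> 'a) \<Rightarrow> real" where
  "bilin_T D \<epsilon> J \<omega> f u v =
    (deriv ^^ 2) f 0 / (\<epsilon> ^ (DIM('a) + 1) * vol_unit_ball TYPE('a)) *
    (LINT x:D|lborel. (LINT y:D|lborel.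
      \<omega> x * \<omega> y * J_eps \<epsilon> J (norm (y - x)) * norm (y - x) *
        bond_strain u y x * bond_strain v y x))"

definition bilin_D ::
  "'a::euclidean_space set \<Rightarrow> real \<Rightarrow> (real \<Rightarrow> real) \<Rightarrow> ('a \<Rightarrow> real) \<Rightarrow> (real \<Rightarrow> real) \<Rightarrow>
    ('a \<Rightarrow> 'a) \<Rightarrow> ('a \<Rightarrow> 'a) \<Rightarrow> real" where
  "bilin_D D \<epsilon> J \<omega> g u v =
    (deriv ^^ 2) g 0 / \<epsilon>\<^sup>2 *
    (LINT x:D|lborel. \<omega> x * hydro_strain \<epsilon> J \<omega> u x * hydro_strain \<epsilon> J \<omega> v x)"

definition bilin ::
  "'a::euclidean_space set \<Rightarrow> real \<Rightarrow> (real \<Rightarrow> real) \<Rightarrow> ('a \<Rightarrow> real) \<Rightarrow> (real \<Rightarrow> real) \<Rightarrow>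
    (real \<Rightarrow> real) \<Rightarrow> ('a \<Rightarrow> 'a) \<Rightarrow> ('a \<Rightarrow> 'a) \<Rightarrow> real" where
  "bilin D \<epsilon> J \<omega> f g u v = bilin_T D \<epsilon> J \<omega> f u v + bilin_D D \<epsilon> J \<omega> g u v"

section \<open>Central difference scheme and discrete energy\<close>

definition central_difference_scheme ::
  "'a::euclidean_space set \<Rightarrow> ('a \<Rightarrow> 'a) set \<Rightarrow> (('a \<Rightarrow> 'a) \<Rightarrow> 'a \<Rightarrow> 'a) \<Rightarrow> real \<Rightarrow>
    (nat \<Rightarrow> 'a \<Rightarrow> 'a) \<Rightarrow> ('a \<Rightarrow> 'a) \<Rightarrow> (nat \<Rightarrow> 'a \<Rightarrow> 'a) \<Rightarrow> bool" where
  "central_difference_scheme D V L \<Delta>t bh vh0 u \<longleftrightarrow>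
    (\<forall>k\<ge>1. \<forall>w\<in>V.
      L2_inner D (\<lambda>x. (u (k + 1) x - 2 *\<^sub>R u k x + u (k - 1) x) /\<^sub>R \<Delta>t\<^sup>2) w =
        L2_inner D (L (u k)) w + L2_inner D (bh k) w) \<and>
    (\<forall>w\<in>V.
      L2_inner D (\<lambda>x. (u 1 x - u 0 x) /\<^sub>R \<Delta>t\<^sup>2) w =
        1 / 2 * L2_inner D (L (u 0)) w + 1 / \<Delta>t * L2_inner D vh0 w
          + 1 / 2 * L2_inner D (bh 0) w)"

definition time_diff :: "real \<Rightarrow> (nat \<Rightarrow> 'a::real_vector \<Rightarrow> 'a) \<Rightarrow> nat \<Rightarrow> 'a \<Rightarrow> 'a" where
  "time_diff \<Delta>t u k x = (u (k + 1) x - u k x) /\<^sub>R \<Delta>t"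

text \<open>\<open>time_avg u k\<close> is the average of the \<open>k\<close>-th and \<open>(k + 1)\<close>-st iterates.\<close>

definition time_avg :: "(nat \<Rightarrow> 'a::real_vector \<Rightarrow> 'a) \<Rightarrow> nat \<Rightarrow> 'a \<Rightarrow> 'a" where
  "time_avg u k x = (u (k + 1) x + u k x) /\<^sub>R 2"

definition discrete_energy ::
  "'a::euclidean_space set \<Rightarrow> (('a \<Rightarrow> 'a) \<Rightarrow> ('a \<Rightarrow> 'a) \<Rightarrow> real) \<Rightarrow> real \<Rightarrow>
    (nat \<Rightarrow> 'a \<Rightarrow> 'a) \<Rightarrow> nat \<Rightarrow> real" where
  "discrete_energy D a \<Delta>t u k =
    1 / 2 * ((L2_norm D (time_diff \<Delta>t u k))\<^sup>2
      - \<Delta>t\<^sup>2 / 4 * a (time_diff \<Delta>t u k) (time_diff \<Delta>t u k)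
      + a (time_avg u k) (time_avg u k))"

end

theory Submission
  imports Defs
begin

text \<open>The linearized force is the negative gradient of a quadratic energy: tested against a finite
  element function \<open>v\<close> it gives \<open>-a(u, v)\<close>, where \<open>a\<close> is the symmetric bilinear form of the
  linearized peridynamic energy (\<open>force_weak_form\<close>). This is Newton's third law: the force density
  on the bond from \<open>x\<close> to \<open>y\<close> is the opposite of that on the bond from \<open>y\<close> to \<open>x\<close>, so averaging the
  double integral over the two orientations turns \<open>v(x)\<close> into half the difference \<open>v(x) - v(y)\<close>,
  whose component along the bond is, up to sign and the bond length, the bond strain of \<open>v\<close>.

  Without body force the scheme thus reads \<open>(u\<^sup>+ - 2u + u\<^sup>-, w) = -\<Delta>t\<^sup>2 a(u, w)\<close>. The choice
  \<open>w = u\<^sup>+ - u\<^sup>-\<close> makes both sides telescope. On the left,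
  \<open>u\<^sup>+ - 2u + u\<^sup>-\<close> and \<open>w\<close> are the difference and the sum of two consecutive increments. On the right,
  \<open>a(u\<^sup>+, u)\<close> is a polarized form: it equals
  \<open>a((u\<^sup>+ + u)/2, (u\<^sup>+ + u)/2) - a((u\<^sup>+ - u)/2, (u\<^sup>+ - u)/2)\<close>, which is the part of the discrete energy
  that involves \<open>a\<close>. Hence the energy is the same at consecutive steps (\<open>leapfrog_energy_step\<close>), and this
  uses of \<open>a\<close> and of the inner product only that they are symmetric and bilinear.

  The energy is nonnegative because the CFL condition says that \<open>\<Delta>t\<^sup>2/4 a\<close> is dominated by the inner
  product on the finite element space, and because \<open>a\<close> itself is nonnegative: its coefficients
  \<open>f''(0)\<close> and \<open>g''(0)\<close> are second derivatives at a local minimum.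

  What remains is integrability. Finite element functions are Lipschitz with compact support
  (\<open>fe_space_subset_compact_lipschitz\<close>), so bond strains are bounded although they contain the factor
  \<open>1/|y - x|\<close>; since bonds are shorter than the horizon, all integrands are bounded measurable functions
  of bounded support.\<close>

section \<open>Energy conservation for central differences\<close>

definition function_subspace :: "('a \<Rightarrow> 'b::real_vector) set \<Rightarrow> bool" where
  "function_subspace V \<longleftrightarrow>
    (\<forall>u\<in>V. \<forall>v\<in>V. \<forall>\<alpha> \<beta>. (\<lambda>x. \<alpha> *\<^sub>R u x + \<beta> *\<^sub>R v x) \<in> V)"

text \<open>Linearity in the first argument is enough, since symmetry transfers it to the second.\<close>

definition symmetric_bilinear_on ::
  "('a \<Rightarrow> 'b::real_vector) set \<Rightarrow> (('a \<Rightarrow> 'b) \<Rightarrow> ('a \<Rightarrow> 'b) \<Rightarrow> real) \<Rightarrow> bool" where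
  "symmetric_bilinear_on V B \<longleftrightarrow>
    (\<forall>u\<in>V. \<forall>v\<in>V. B u v = B v u) \<and>
    (\<forall>u\<in>V. \<forall>v\<in>V. \<forall>w\<in>V. \<forall>\<alpha> \<beta>.
      B (\<lambda>x. \<alpha> *\<^sub>R u x + \<beta> *\<^sub>R v x) w = \<alpha> * B u w + \<beta> * B v w)"

lemma symmetric_bilinear_on_subset:
  assumes "symmetric_bilinear_on V B" "W \<subseteq> V"
  shows "symmetric_bilinear_on W B"
  using assms unfolding symmetric_bilinear_on_def by (meson subsetD)

lemma quadratic_form_expand:
  assumes V: "function_subspace V" and B: "symmetric_bilinear_on V B" and uv: "u \<in> V" "v \<in> V"
  shows "B (\<lambda>x. \<alpha> *\<^sub>R u x + \<beta> *\<^sub>R v x) (\<lambda>x. \<alpha> *\<^sub>R u x + \<beta> *\<^sub>R v x) =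
    \<alpha>\<^sup>2 * B u u + 2 * \<alpha> * \<beta> * B u v + \<beta>\<^sup>2 * B v v"
proof -
  let ?c = "\<lambda>x. \<alpha> *\<^sub>R u x + \<beta> *\<^sub>R v x"
  have c: "?c \<in> V" using V uv unfolding function_subspace_def by blast
  have lin: "B ?c w = \<alpha> * B u w + \<beta> * B v w" if "w \<in> V" for w
    using B uv that unfolding symmetric_bilinear_on_def by blast
  have sym: "B s t = B t s" if "s \<in> V" "t \<in> V" for s t
    using B that unfolding symmetric_bilinear_on_def by blast
  have "B ?c ?c = \<alpha> * B ?c u + \<beta> * B ?c v"
    using lin[OF c] sym[OF uv(1) c] sym[OF uv(2) c] by simp
  also have "\<dots> = \<alpha> * (\<alpha> * B u u + \<beta> * B u v) + \<beta> * (\<alpha> * B u v + \<beta> * B v v)"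
    using lin[OF uv(1)] lin[OF uv(2)] sym[OF uv] by simp
  finally show ?thesis by (simp add: algebra_simps power2_eq_square)
qed

text \<open>The discrete energy \<open>E s t\<close> of two consecutive states simplifies to
  \<open>m(t - s, t - s)/\<tau>\<^sup>2 + a(t, s)\<close>: the two \<open>a\<close>-terms are a polarization identity. The scheme tested
  against \<open>r - p\<close> equates the changes of both summands up to sign.\<close>

lemma leapfrog_energy_step:
  fixes p q r :: "'a \<Rightarrow> 'b::real_vector" and \<tau> :: real
  assumes V: "function_subspace V"
    and m: "symmetric_bilinear_on V m" and a: "symmetric_bilinear_on V a"
    and pqr: "p \<in> V" "q \<in> V" "r \<in> V" and \<tau>: "\<tau> \<noteq> 0"
    and scheme: "\<And>w. w \<in> V \<Longrightarrow> m (\<lambda>x. (r x - 2 *\<^sub>R q x + p x) /\<^sub>R \<tau>\<^sup>2) w = - a q w"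
  defines "E \<equiv> \<lambda>s t. m (\<lambda>x. (t x - s x) /\<^sub>R \<tau>) (\<lambda>x. (t x - s x) /\<^sub>R \<tau>)
      - \<tau>\<^sup>2 / 4 * a (\<lambda>x. (t x - s x) /\<^sub>R \<tau>) (\<lambda>x. (t x - s x) /\<^sub>R \<tau>)
      + a (\<lambda>x. (t x + s x) /\<^sub>R 2) (\<lambda>x. (t x + s x) /\<^sub>R 2)"
  shows "E q r = E p q"
proof -
  have diff: "(\<lambda>x. (t x - s x) /\<^sub>R \<tau>) = (\<lambda>x. (1/\<tau>) *\<^sub>R t x + (-1/\<tau>) *\<^sub>R s x)"
    for s t :: "'a \<Rightarrow> 'b"
    by (simp add: fun_eq_iff scaleR_diff_right inverse_eq_divide)
  have avg: "(\<lambda>x. (t x + s x) /\<^sub>R 2) = (\<lambda>x. (1/2) *\<^sub>R t x + (1/2) *\<^sub>R s x)"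
    for s t :: "'a \<Rightarrow> 'b"
    by (simp add: fun_eq_iff scaleR_add_right inverse_eq_divide)
  have E: "E s t = (m t t - 2 * m t s + m s s) / \<tau>\<^sup>2 + a t s" if "s \<in> V" "t \<in> V" for s t
    unfolding E_def diff avg
      quadratic_form_expand[OF V m that(2,1)] quadratic_form_expand[OF V a that(2,1)]
    using \<tau> by (simp add: field_simps power2_eq_square)
  define w where "w = (\<lambda>x. 1 *\<^sub>R r x + (-1) *\<^sub>R p x)"
  have w: "w \<in> V"
    using V pqr unfolding function_subspace_def w_def by blast
  have lin: "B (\<lambda>x. \<alpha> *\<^sub>R s x + \<beta> *\<^sub>R t x) z = \<alpha> * B s z + \<beta> * B t z"
    if "symmetric_bilinear_on V B" "s \<in> V" "t \<in> V" "z \<in> V" for B s t z \<alpha> \<beta>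
    using that unfolding symmetric_bilinear_on_def by blast
  have sym: "B s t = B t s" if "symmetric_bilinear_on V B" "s \<in> V" "t \<in> V" for B s t
    using that unfolding symmetric_bilinear_on_def by blast
  have w_right: "B s w = B s r - B s p" if "symmetric_bilinear_on V B" "s \<in> V" for B s
    using lin[OF that(1) pqr(3,1) that(2), of 1 "-1"] sym[OF that(1)] that(2) pqr w
    by (simp add: w_def)
  define z where "z = (\<lambda>x. (1/\<tau>\<^sup>2) *\<^sub>R r x + (-2/\<tau>\<^sup>2) *\<^sub>R q x)"
  have z: "z \<in> V"
    using V pqr unfolding function_subspace_def z_def by blast
  have second_diff: "(\<lambda>x. (r x - 2 *\<^sub>R q x + p x) /\<^sub>R \<tau>\<^sup>2) = (\<lambda>x. 1 *\<^sub>R z x + (1/\<tau>\<^sup>2) *\<^sub>R p x)"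
    by (simp add: fun_eq_iff z_def scaleR_diff_right scaleR_add_right inverse_eq_divide)
  have "m (\<lambda>x. (r x - 2 *\<^sub>R q x + p x) /\<^sub>R \<tau>\<^sup>2) w = m z w + (1/\<tau>\<^sup>2) * m p w"
    unfolding second_diff using lin[OF m z pqr(1) w, of 1] by simp
  also have "m z w = (1/\<tau>\<^sup>2) * m r w + (-2/\<tau>\<^sup>2) * m q w"
    unfolding z_def by (rule lin[OF m pqr(3,2) w])
  finally have "(m r w - 2 * m q w + m p w) / \<tau>\<^sup>2 = - a q w"
    using scheme[OF w] by (simp add: add_divide_distrib diff_divide_distrib)
  then have "(m r r - 2 * m q r + 2 * m q p - m p p) / \<tau>\<^sup>2 = a q p - a q r"
    unfolding w_right[OF m pqr(1)] w_right[OF m pqr(2)] w_right[OF m pqr(3)]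
      w_right[OF a pqr(2)]
    using sym[OF m pqr(1,3)] by (simp add: algebra_simps)
  then show ?thesis
    unfolding E[OF pqr(1,2)] E[OF pqr(2,3)]
    using sym[OF m pqr(2,3)] sym[OF a pqr(2,3)]
    by (simp add: add_divide_distrib diff_divide_distrib)
qed

section \<open>Finite element functions are Lipschitz\<close>

text \<open>These functions form a vector space that contains every finite element space and in which all
  integrals below converge.\<close>

definition compact_lipschitz :: "('a::euclidean_space \<Rightarrow> 'b::real_normed_vector) set" where
  "compact_lipschitz = {u. (\<exists>L. L-lipschitz_on UNIV u) \<and> (\<exists>R. \<forall>x. R < norm x \<longrightarrow> u x = 0)}"

text \<open>A segment from \<open>x\<close> to \<open>y\<close> is covered by the finitely many closed sets in which it meets the
  pieces and by the closed zero set of \<open>u\<close>. On each of them \<open>u\<close> is \<open>L\<close>-Lipschitz along the segment, so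
  it is so on the whole segment by a one-dimensional argument.\<close>

lemma lipschitz_on_UNIV_piecewise:
  fixes u :: "'a::real_normed_vector \<Rightarrow> 'b::real_normed_vector"
  assumes cont: "continuous_on UNIV u" and fin: "finite \<T>" and "0 \<le> L"
    and closed: "\<And>K. K \<in> \<T> \<Longrightarrow> closed K" and lip: "\<And>K. K \<in> \<T> \<Longrightarrow> L-lipschitz_on K u"
    and zero: "\<And>x. x \<notin> \<Union>\<T> \<Longrightarrow> u x = 0"
  shows "L-lipschitz_on UNIV u"
proof (rule lipschitz_onI)
  fix x y :: 'a
  define \<gamma> where "\<gamma> t = x + t *\<^sub>R (y - x)" for t :: real
  have \<gamma>: "continuous_on UNIV \<gamma>" unfolding \<gamma>_def by (intro continuous_intros)
  have dist_\<gamma>: "dist (\<gamma> s) (\<gamma> t) = dist x y * dist s t" for s t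
  proof -
    have "\<gamma> s - \<gamma> t = (s - t) *\<^sub>R (y - x)" by (simp add: \<gamma>_def algebra_simps)
    then show ?thesis by (simp add: dist_norm norm_minus_commute)
  qed
  \<comment> \<open>The zero set stands in for the complement of the pieces, which is not closed.\<close>
  let ?Z = "{z. u z = 0}"
  have Z: "closed ?Z" "L-lipschitz_on ?Z u"
    using cont \<open>0 \<le> L\<close> by (auto intro!: closed_Collect_eq lipschitz_onI)
  have "(L * dist x y)-lipschitz_on {0..1} (u \<circ> \<gamma>)"
  proof (rule lipschitz_on_closed_Union)
    show "(L * dist x y)-lipschitz_on (\<gamma> -` K) (u \<circ> \<gamma>)" if "K \<in> insert ?Z \<T>" for K
    proof (rule lipschitz_onI)
      fix s t assume st: "s \<in> \<gamma> -` K" "t \<in> \<gamma> -` K"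
      have "L-lipschitz_on K u" using that Z lip by blast
      from lipschitz_onD[OF this, of "\<gamma> s" "\<gamma> t"] st
      show "dist ((u \<circ> \<gamma>) s) ((u \<circ> \<gamma>) t) \<le> L * dist x y * dist s t"
        by (simp add: dist_\<gamma> mult.assoc)
    qed (use \<open>0 \<le> L\<close> in simp)
    show "closed (\<gamma> -` K)" if "K \<in> insert ?Z \<T>" for K
      using that Z closed \<gamma> by (intro closed_vimage) auto
    show "finite (insert ?Z \<T>)" using fin by simp
    show "{0..1} \<subseteq> (\<Union>K\<in>insert ?Z \<T>. \<gamma> -` K)" using zero by blast
  qed (use \<open>0 \<le> L\<close> in simp)
  from lipschitz_onD[OF this, of 0 1]
  show "dist (u x) (u y) \<le> L * dist x y" by (simp add: \<gamma>_def)
qed fact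

lemma linear_affine_lipschitz:
  fixes A :: "'a::euclidean_space \<Rightarrow> 'b::real_normed_vector"
  assumes "linear A" "\<And>x. x \<in> K \<Longrightarrow> u x = A x + c"
  shows "(onorm A)-lipschitz_on K u"
proof (rule lipschitz_onI)
  have A: "bounded_linear A" using assms linear_conv_bounded_linear by blast
  show "0 \<le> onorm A" by (rule onorm_pos_le[OF A])
  fix x y assume "x \<in> K" "y \<in> K"
  then have "dist (u x) (u y) = norm (A (x - y))"
    using assms by (simp add: dist_norm linear_diff)
  then show "dist (u x) (u y) \<le> onorm A * dist x y"
    using onorm[OF A, of "x - y"] by (simp add: dist_norm)
qed

lemma fe_space_subset_compact_lipschitz:
  assumes "triangulation \<T>"
  shows "fe_space D \<T> \<subseteq> compact_lipschitz"
proof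
  fix u assume "u \<in> fe_space D \<T>"
  then have cont: "continuous_on UNIV u"
    and pw: "\<And>K. K \<in> \<T> \<Longrightarrow> \<exists>A c. linear A \<and> (\<forall>x\<in>K. u x = A x + c)"
    and zero: "\<And>x. x \<notin> \<Union>\<T> \<Longrightarrow> u x = 0"
    unfolding fe_space_def by auto
  have fin: "finite \<T>" and comp: "\<And>K. K \<in> \<T> \<Longrightarrow> compact K"
    using assms compact_simplex unfolding triangulation_def by blast+
  have "\<forall>K\<in>\<T>. \<exists>L. L-lipschitz_on K u"
    using pw linear_affine_lipschitz by metis
  then obtain L where L: "\<And>K. K \<in> \<T> \<Longrightarrow> (L K)-lipschitz_on K u" by metis
  define B where "B = Max (insert 0 (L ` \<T>))"
  have "B-lipschitz_on UNIV u"
  proof (rule lipschitz_on_UNIV_piecewise[OF cont fin])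
    show "0 \<le> B" using fin by (simp add: B_def)
    show "B-lipschitz_on K u" if "K \<in> \<T>" for K
      using L[OF that] by (rule lipschitz_on_le) (use that fin in \<open>simp add: B_def\<close>)
  qed (use comp zero compact_imp_closed in auto)
  moreover have "bounded (\<Union>\<T>)"
    using fin comp by (auto intro: compact_imp_bounded)
  then obtain R where "\<And>x. x \<in> \<Union>\<T> \<Longrightarrow> norm x \<le> R" unfolding bounded_iff by blast
  then have "\<forall>x. R < norm x \<longrightarrow> u x = 0" using zero by (meson not_le)
  ultimately show "u \<in> compact_lipschitz" unfolding compact_lipschitz_def by blast
qed

lemma function_subspace_fe_space: "function_subspace (fe_space D \<T>)"
  unfolding function_subspace_def
proof (intro ballI allI)
  fix u v :: "'a \<Rightarrow> 'a" and \<alpha> \<beta> :: real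
  assume u: "u \<in> fe_space D \<T>" and v: "v \<in> fe_space D \<T>"
  have "\<exists>A c. linear A \<and> (\<forall>x\<in>K. \<alpha> *\<^sub>R u x + \<beta> *\<^sub>R v x = A x + c)" if "K \<in> \<T>" for K
  proof -
    have "\<exists>A c. linear A \<and> (\<forall>x\<in>K. u x = A x + c)" "\<exists>A c. linear A \<and> (\<forall>x\<in>K. v x = A x + c)"
      using u v \<open>K \<in> \<T>\<close> unfolding fe_space_def by simp_all
    then obtain A c A' c' where A: "linear A" "\<And>x. x \<in> K \<Longrightarrow> u x = A x + c"
      and A': "linear A'" "\<And>x. x \<in> K \<Longrightarrow> v x = A' x + c'"
      by metis
    have "linear (\<lambda>x. \<alpha> *\<^sub>R A x + \<beta> *\<^sub>R A' x)"
      using A(1) A'(1) by (intro linear_compose_add linear_compose_scale_right)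
    moreover have "\<forall>x\<in>K. \<alpha> *\<^sub>R u x + \<beta> *\<^sub>R v x =
        (\<alpha> *\<^sub>R A x + \<beta> *\<^sub>R A' x) + (\<alpha> *\<^sub>R c + \<beta> *\<^sub>R c')"
      using A A' by (simp add: algebra_simps)
    ultimately show ?thesis by blast
  qed
  moreover have "continuous_on UNIV (\<lambda>x. \<alpha> *\<^sub>R u x + \<beta> *\<^sub>R v x)"
    using u v unfolding fe_space_def by (intro continuous_intros) simp_all
  moreover have "\<alpha> *\<^sub>R u x + \<beta> *\<^sub>R v x = 0" if "x \<notin> D \<inter> \<Union>\<T>" for x
    using u v that unfolding fe_space_def by simp
  ultimately show "(\<lambda>x. \<alpha> *\<^sub>R u x + \<beta> *\<^sub>R v x) \<in> fe_space D \<T>"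
    unfolding fe_space_def by simp
qed

section \<open>Potentials with a well at the origin\<close>

text \<open>At a local minimum the first derivative vanishes. If the second one were negative, the first
  derivative would be negative just to the right of \<open>c\<close>, and \<open>f\<close> would fall below \<open>f c\<close> there.\<close>

lemma local_min_second_derivative_nonneg:
  fixes f :: "real \<Rightarrow> real"
  assumes diff: "\<And>x. f differentiable (at x)" and f'': "deriv f differentiable (at c)"
    and r: "r > 0" and min: "\<And>x. dist c x < r \<Longrightarrow> f c \<le> f x"
  shows "0 \<le> deriv (deriv f) c"
proof (rule ccontr)
  assume "\<not> ?thesis"
  then have neg: "deriv (deriv f) c < 0" by simp
  have D: "(f has_real_derivative deriv f x) (at x)" for x
    using diff by (simp add: DERIV_deriv_iff_real_differentiable)
  have D2: "(deriv f has_real_derivative deriv (deriv f) c) (at c)"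
    using f'' by (simp add: DERIV_deriv_iff_real_differentiable)
  have "deriv f c = 0"
    using DERIV_local_min[OF D r, of c] min by (simp add: dist_real_def)
  then obtain d where d: "d > 0" "\<And>h. 0 < h \<Longrightarrow> h < d \<Longrightarrow> deriv f (c + h) < 0"
    using DERIV_neg_dec_right[OF D2 neg] by auto
  define h where "h = min d r / 2"
  have h: "0 < h" "h < d" "h < r" using d r by (auto simp: h_def)
  obtain z where z: "c < z" "z < c + h" "f (c + h) - f c = (c + h - c) * deriv f z"
    using MVT2[of c "c + h" f "deriv f"] D h by auto
  have "deriv f z < 0" using d(2)[of "z - c"] z h by auto
  with h have "(c + h - c) * deriv f z < 0" by (intro mult_pos_neg) auto
  then have "f (c + h) < f c" unfolding z(3)[symmetric] by linarith
  moreover have "f c \<le> f (c + h)" using min[of "c + h"] h by (simp add: dist_real_def)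
  ultimately show False by simp
qed

lemma potential_second_derivative_nonneg:
  assumes "potential f"
  shows "0 \<le> (deriv ^^ 2) f 0"
proof -
  have *: "\<And>n. n < 4 \<Longrightarrow> (deriv ^^ n) f differentiable_on UNIV"
    and "\<exists>r>0. \<forall>x\<in>ball 0 r. f 0 \<le> f x"
    using assms unfolding potential_def by blast+
  then obtain r where "r > 0" "\<And>x. dist 0 x < r \<Longrightarrow> f 0 \<le> f x" by auto
  then have "0 \<le> deriv (deriv f) 0"
    using *[of 0] *[of 1]
    by (intro local_min_second_derivative_nonneg) (auto simp: differentiable_on_def)
  then show ?thesis by (simp add: numeral_2_eq_2)
qed

section \<open>Integrals with bounded support and double integrals\<close>

lemma integrable_bounded_support:
  fixes f :: "'a::euclidean_space \<Rightarrow> 'b::{banach, second_countable_topology}"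
  assumes [measurable]: "f \<in> borel_measurable lborel"
    and "\<And>x. norm (f x) \<le> B" and "\<And>x. R < norm x \<Longrightarrow> f x = 0"
  shows "integrable lborel f"
proof (rule integrableI_bounded_set[where A = "cball 0 R" and B = B])
  show "emeasure lborel (cball (0::'a) R) < \<infinity>"
    by (rule emeasure_lborel_cball_finite)
qed (use assms in auto)

lemma set_integral_eq_integral:
  fixes f :: "'a \<Rightarrow> 'b::{banach, second_countable_topology}"
  assumes "\<And>x. x \<notin> A \<Longrightarrow> f x = 0"
  shows "(LINT x:A|M. f x) = integral\<^sup>L M f"
  unfolding set_lebesgue_integral_def
  by (rule Bochner_Integration.integral_cong) (use assms in \<open>auto simp: indicator_def\<close>)

lemma integral_double_lin:
  fixes G :: "'a::euclidean_space \<Rightarrow> 'a \<Rightarrow> real"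
  assumes "integrable (lborel \<Otimes>\<^sub>M lborel) (\<lambda>(x, y). G x y)"
    "integrable (lborel \<Otimes>\<^sub>M lborel) (\<lambda>(x, y). H x y)"
  shows "(\<integral>x. \<integral>y. \<alpha> * G x y + \<beta> * H x y \<partial>lborel \<partial>lborel) =
    \<alpha> * (\<integral>x. \<integral>y. G x y \<partial>lborel \<partial>lborel) + \<beta> * (\<integral>x. \<integral>y. H x y \<partial>lborel \<partial>lborel)"
proof -
  have iterated: "(\<integral>x. \<integral>y. F (x, y) \<partial>lborel \<partial>lborel) = integral\<^sup>L (lborel \<Otimes>\<^sub>M lborel) F"
    if "integrable (lborel \<Otimes>\<^sub>M lborel) F" for F :: "'a \<times> 'a \<Rightarrow> real"
    using lborel_pair.integral_fst'[OF that] by simp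
  show ?thesis
    using iterated[of "\<lambda>z. \<alpha> * case_prod G z + \<beta> * case_prod H z"]
      iterated[OF assms(1)] iterated[OF assms(2)] assms
    by simp
qed

text \<open>If the integral vanished, the open set where \<open>w\<close> is nonzero would be negligible, hence empty.\<close>

lemma continuous_integral_norm_pos:
  fixes w :: "'a::euclidean_space \<Rightarrow> 'b::euclidean_space"
  assumes cont: "continuous_on UNIV w" and int: "integrable lborel (\<lambda>x. (norm (w x))\<^sup>2)"
    and "w \<noteq> (\<lambda>_. 0)"
  shows "0 < (\<integral>x. (norm (w x))\<^sup>2 \<partial>lborel)"
proof -
  have "0 \<noteq> (\<integral>x. (norm (w x))\<^sup>2 \<partial>lborel)"
  proof
    assume "0 = (\<integral>x. (norm (w x))\<^sup>2 \<partial>lborel)"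
    then have "AE x in lborel. w x = 0"
      using integral_nonneg_eq_0_iff_AE[OF int] by simp
    moreover have S: "open {x. w x \<noteq> 0}"
      using cont by (intro open_Collect_neq) auto
    moreover have "{x. w x \<noteq> 0} \<in> sets lborel"
      using S by simp
    ultimately have "{x. w x \<noteq> 0} \<in> null_sets lborel"
      by (simp add: AE_iff_null_sets)
    then have "negligible {x. w x \<noteq> 0}"
      by (simp add: negligible_iff_null_sets null_sets_completionI)
    then have "{x. w x \<noteq> 0} = {}" using open_not_negligible S by blast
    with assms(3) show False by auto
  qed
  moreover have "0 \<le> (\<integral>x. (norm (w x))\<^sup>2 \<partial>lborel)" by simp
  ultimately show ?thesis by linarith
qed

text \<open>A double integral depends only on the symmetric part of its integrand, because exchanging the
  two variables does not change it. This is how action and reaction along a bond are combined.\<close>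

lemma integral_double_symmetrize_cong:
  fixes G H :: "'a::euclidean_space \<Rightarrow> 'a \<Rightarrow> real"
  assumes G: "integrable (lborel \<Otimes>\<^sub>M lborel) (\<lambda>(x, y). G x y)"
    and H: "integrable (lborel \<Otimes>\<^sub>M lborel) (\<lambda>(x, y). H x y)"
    and eq: "\<And>x y. G x y + G y x = H x y + H y x"
  shows "(\<integral>x. \<integral>y. G x y \<partial>lborel \<partial>lborel) = (\<integral>x. \<integral>y. H x y \<partial>lborel \<partial>lborel)"
proof -
  have sym: "2 * (\<integral>x. \<integral>y. F x y \<partial>lborel \<partial>lborel) =
      (\<integral>x. \<integral>y. F x y + F y x \<partial>lborel \<partial>lborel)"
    if F: "integrable (lborel \<Otimes>\<^sub>M lborel) (\<lambda>(x, y). F x y)" for F :: "'a \<Rightarrow> 'a \<Rightarrow> real"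
  proof -
    have F': "integrable (lborel \<Otimes>\<^sub>M lborel) (\<lambda>(x, y). F y x)"
      using lborel_pair.integrable_product_swap[OF F] by simp
    show ?thesis
      using integral_double_lin[OF F F', of 1 1] lborel_pair.Fubini_integral[OF F] by simp
  qed
  show ?thesis using sym[OF G] sym[OF H] by (simp add: eq)
qed

section \<open>Bond directions and bond strains\<close>

lemma norm_bond_dir_le: "norm (bond_dir y x) \<le> 1"
  by (cases "y = x") (simp_all add: bond_dir_def)

lemma bond_dir_commute: "bond_dir x y = - bond_dir y x"
  unfolding bond_dir_def by (metis minus_diff_eq norm_minus_commute scaleR_minus_right)

lemma bond_strain_commute: "bond_strain u x y = bond_strain u y x"
  unfolding bond_strain_def bond_dir_commute[of x y]
  by (simp add: norm_minus_commute inner_diff_left algebra_simps)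

text \<open>This holds for the degenerate bond \<open>y = x\<close> too, where \<open>bond_dir\<close> and \<open>bond_strain\<close> are 0 by the
  convention for division by 0. So the diagonal needs no separate treatment under the integrals.\<close>

lemma bond_strain_times_norm: "bond_strain u y x * norm (y - x) = (u y - u x) \<bullet> bond_dir y x"
  by (cases "y = x") (simp_all add: bond_strain_def bond_dir_def)

lemma bond_strain_linear:
  "bond_strain (\<lambda>x. \<alpha> *\<^sub>R u x + \<beta> *\<^sub>R v x) y x = \<alpha> * bond_strain u y x + \<beta> * bond_strain v y x"
  unfolding bond_strain_def by (simp add: algebra_simps)

text \<open>The Lipschitz bound absorbs the singular factor \<open>1/|y - x|\<close>, in every dimension.\<close>

lemma abs_bond_strain_le:
  assumes "L-lipschitz_on UNIV u"
  shows "\<bar>bond_strain u y x\<bar> \<le> L"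
proof (cases "y = x")
  case True
  then show ?thesis using lipschitz_on_nonneg[OF assms] by (simp add: bond_strain_def)
next
  case False
  have "\<bar>bond_strain u y x\<bar> \<le> norm ((u y - u x) /\<^sub>R norm (y - x)) * norm (bond_dir y x)"
    unfolding bond_strain_def by (rule Cauchy_Schwarz_ineq2)
  also have "\<dots> \<le> norm ((u y - u x) /\<^sub>R norm (y - x)) * 1"
    by (intro mult_left_mono norm_bond_dir_le) simp
  also have "\<dots> = norm (u y - u x) / norm (y - x)" by (simp add: divide_inverse mult.commute)
  also have "\<dots> \<le> L"
    using lipschitz_onD[OF assms, of y x] False by (simp add: divide_le_eq dist_norm)
  finally show ?thesis .
qed

lemma measurable_bond_dir [measurable]:
  assumes [measurable]: "f \<in> borel_measurable N" "g \<in> borel_measurable N"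
  shows "(\<lambda>z. bond_dir (f z) (g z)) \<in> borel_measurable N"
  unfolding bond_dir_def by measurable

lemma measurable_bond_strain [measurable]:
  assumes [measurable]: "u \<in> borel_measurable borel" "f \<in> borel_measurable N" "g \<in> borel_measurable N"
  shows "(\<lambda>z. bond_strain u (f z) (g z)) \<in> borel_measurable N"
  unfolding bond_strain_def by measurable

lemma compact_lipschitz_measurable:
  fixes u :: "'a::euclidean_space \<Rightarrow> 'b::euclidean_space"
  assumes "u \<in> compact_lipschitz"
  shows "u \<in> borel_measurable borel"
  using assms lipschitz_on_continuous_on
  unfolding compact_lipschitz_def by (auto intro: borel_measurable_continuous_onI)

lemma compact_lipschitz_bounded:
  assumes "u \<in> compact_lipschitz"
  shows "\<exists>B. \<forall>x. norm (u x) \<le> B" "\<exists>R. \<forall>x. R < norm x \<longrightarrow> u x = 0"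
proof -
  obtain L R where u: "L-lipschitz_on UNIV u" and R: "\<And>x. R < norm x \<Longrightarrow> u x = 0"
    using assms unfolding compact_lipschitz_def by blast
  have "norm (u x) \<le> norm (u 0) + L * \<bar>R\<bar>" for x
  proof (cases "R < norm x")
    case True
    then show ?thesis using R lipschitz_on_nonneg[OF u] by simp
  next
    case False
    have "norm (u x) \<le> norm (u 0) + dist (u x) (u 0)"
      using norm_triangle_sub[of "u x" "u 0"] by (simp add: dist_norm)
    also have "dist (u x) (u 0) \<le> L * norm x"
      using lipschitz_onD[OF u, of x 0] by simp
    also have "\<dots> \<le> L * \<bar>R\<bar>"
      using False lipschitz_on_nonneg[OF u] by (intro mult_left_mono) auto
    finally show ?thesis by simp
  qed
  then show "\<exists>B. \<forall>x. norm (u x) \<le> B" by blast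
  show "\<exists>R. \<forall>x. R < norm x \<longrightarrow> u x = 0" using R by blast
qed

section \<open>The linearized force as the gradient of the energy\<close>

locale peridynamic_medium =
  fixes D :: "'a::euclidean_space set" and \<epsilon> M :: real and J :: "real \<Rightarrow> real" and \<omega> :: "'a \<Rightarrow> real"
  assumes D_borel [measurable]: "D \<in> sets borel"
    and horizon_pos: "0 < \<epsilon>"
    and influence: "influence_function M J"
    and \<omega>_measurable [measurable]: "\<omega> \<in> borel_measurable borel"
    and \<omega>_range: "0 \<le> \<omega> x" "\<omega> x \<le> 1"
    and \<omega>_outside: "x \<notin> D \<Longrightarrow> \<omega> x = 0"
begin

abbreviation weight :: "'a \<Rightarrow> 'a \<Rightarrow> real" where
  "weight x y \<equiv> \<omega> x * \<omega> y * J_eps \<epsilon> J (norm (y - x))"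

abbreviation \<theta> :: "('a \<Rightarrow> 'a) \<Rightarrow> 'a \<Rightarrow> real" where
  "\<theta> \<equiv> hydro_strain \<epsilon> J \<omega>"

lemma horizon_volume_pos: "0 < (\<epsilon> ^ DIM('a) * vol_unit_ball TYPE('a))"
  using horizon_pos content_ball_gt_0_iff[of "0::'a" 1] by (simp add: vol_unit_ball_def)

text \<open>The influence function is assumed measurable only on \<open>{0..}\<close>, which is where it is evaluated.\<close>

lemma measurable_J_eps [measurable]:
  fixes f :: "_ \<Rightarrow> 'a"
  assumes [measurable]: "f \<in> borel_measurable N"
  shows "(\<lambda>z. J_eps \<epsilon> J (norm (f z))) \<in> borel_measurable N"
proof -
  have [measurable]: "(\<lambda>r. indicator {0..} r *\<^sub>R J r) \<in> borel_measurable borel"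
    using influence unfolding influence_function_def set_borel_measurable_def by blast
  have "(\<lambda>z. indicator {0..} (norm (f z) / \<epsilon>) *\<^sub>R J (norm (f z) / \<epsilon>)) \<in> borel_measurable N"
    by (rule measurable_compose[where N = borel and g = "\<lambda>r. indicator {0..} r *\<^sub>R J r"]) measurable
  then show ?thesis using horizon_pos by (simp add: J_eps_def)
qed

lemma J_eps_far: "\<epsilon> \<le> r \<Longrightarrow> J_eps \<epsilon> J r = 0"
  using influence horizon_pos by (simp add: influence_function_def J_eps_def)

lemma J_eps_range:
  assumes "0 \<le> r"
  shows "0 \<le> J_eps \<epsilon> J r" "J_eps \<epsilon> J r \<le> M"
proof -
  have J: "0 \<le> J s" "J s \<le> M" if "0 \<le> s" "s < 1" for s
    using influence that by (auto simp: influence_function_def)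
  have "0 \<le> M" using J[of 0] by simp
  then have "0 \<le> J_eps \<epsilon> J r \<and> J_eps \<epsilon> J r \<le> M"
    using J_eps_far[of r] J[of "r / \<epsilon>"] assms horizon_pos
    by (cases "r < \<epsilon>") (auto simp: J_eps_def)
  then show "0 \<le> J_eps \<epsilon> J r" "J_eps \<epsilon> J r \<le> M" by auto
qed

lemma M_nonneg: "0 \<le> M"
  using J_eps_range[of 0] by simp

lemma weight_far: "\<epsilon> \<le> norm (y - x) \<Longrightarrow> weight x y = 0"
  by (simp add: J_eps_far)

lemma weight_commute: "weight y x = weight x y"
  by (simp add: norm_minus_commute)

lemma weight_nonneg: "0 \<le> weight x y"
  using \<omega>_range J_eps_range by simp

lemma weight_le: "weight x y \<le> M"
proof -
  have "\<omega> x * \<omega> y \<le> 1" using \<omega>_range by (simp add: mult_le_one)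
  then have "weight x y \<le> 1 * J_eps \<epsilon> J (norm (y - x))"
    using J_eps_range by (intro mult_right_mono) auto
  also have "\<dots> \<le> M" using J_eps_range by simp
  finally show ?thesis .
qed

lemma abs_weight_mult_le:
  assumes "\<bar>s\<bar> \<le> C"
  shows "\<bar>weight x y * s\<bar> \<le> M * C"
  unfolding abs_mult[of "weight x y"]
  using weight_nonneg[of x y] weight_le[of x y] assms M_nonneg by (intro mult_mono) auto

text \<open>If \<open>s x y\<close> vanishes for \<open>x\<close> outside a ball, the weighted integrand has bounded support in both
  variables, because the weight confines \<open>y\<close> to the \<open>\<epsilon>\<close>-neighbourhood of \<open>x\<close>.\<close>

lemma integrable_bond_pairs:
  fixes s :: "'a \<Rightarrow> 'a \<Rightarrow> real"
  assumes [measurable]: "(\<lambda>(x, y). s x y) \<in> borel_measurable (lborel \<Otimes>\<^sub>M lborel)"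
    and bound: "\<And>x y. norm (y - x) < \<epsilon> \<Longrightarrow> \<bar>s x y\<bar> \<le> C"
    and support: "\<And>x y. norm (y - x) < \<epsilon> \<Longrightarrow> R < norm x \<Longrightarrow> s x y = 0"
  shows "integrable (lborel \<Otimes>\<^sub>M lborel) (\<lambda>(x, y). weight x y * s x y)"
proof -
  have "integrable lborel (\<lambda>(x, y). weight x y * s x y)"
  \<comment> \<open>If \<open>|x| \<le> R\<close> and \<open>|y - x| < \<epsilon>\<close>, then \<open>|(x, y)| \<le> |x| + |y| \<le> 2R + \<epsilon>\<close>.\<close>
  proof (rule integrable_bounded_support[where B = "M * \<bar>C\<bar>" and R = "2 * R + \<epsilon>"])
    show "(\<lambda>(x, y). weight x y * s x y) \<in> borel_measurable lborel"
      unfolding lborel_prod[symmetric] by measurable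
    show "norm (case z of (x, y) \<Rightarrow> weight x y * s x y) \<le> M * \<bar>C\<bar>" for z
    proof (cases z)
      case (Pair x y)
      have "\<bar>weight x y * s x y\<bar> \<le> M * \<bar>C\<bar>"
        using abs_weight_mult_le[of "s x y" "\<bar>C\<bar>" x y] bound[of y x] weight_far[of y x] M_nonneg
        by (cases "norm (y - x) < \<epsilon>") auto
      then show ?thesis by (simp add: Pair)
    qed
    show "(case z of (x, y) \<Rightarrow> weight x y * s x y) = 0" if "2 * R + \<epsilon> < norm z" for z
    proof (cases z)
      case (Pair x y)
      have "norm z \<le> norm x + norm y" unfolding Pair by (rule norm_Pair_le)
      moreover have "norm y \<le> norm x + norm (y - x)" by (rule norm_triangle_sub)
      ultimately have "\<epsilon> \<le> norm (y - x) \<or> R < norm x" using that by linarith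
      then have "weight x y * s x y = 0"
        using support[of y x] weight_far[of y x] by (cases "norm (y - x) < \<epsilon>") auto
      then show ?thesis by (simp add: Pair)
    qed
  qed
  then show ?thesis by (simp add: lborel_prod)
qed

text \<open>Both parts of the force are vector integrals of this form, with \<open>s\<close> a multiple of the bond strain
  or a sum of hydrostatic strains; pairing with \<open>w\<close> reduces them to scalar integrals over the whole
  space.\<close>

lemma ball_integral_inner:
  assumes [measurable]: "s \<in> borel_measurable borel" and bound: "\<And>y. \<bar>s y\<bar> \<le> C"
  shows "(LINT y:ball x \<epsilon>|lborel. (weight x y * s y) *\<^sub>R bond_dir y x) \<bullet> w =
    (\<integral>y. weight x y * (s y * (bond_dir y x \<bullet> w)) \<partial>lborel)"
proof -
  have "integrable lborel (\<lambda>y. (weight x y * s y) *\<^sub>R bond_dir y x)"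
  proof (rule integrable_bounded_support[where B = "M * C" and R = "norm x + \<epsilon>"])
    show "norm ((weight x y * s y) *\<^sub>R bond_dir y x) \<le> M * C" for y
      unfolding norm_scaleR
      using mult_mono[OF abs_weight_mult_le[OF bound, of x y] norm_bond_dir_le[of y x]]
        order_trans[OF abs_ge_zero abs_weight_mult_le[OF bound, of x y]] by simp
    show "(weight x y * s y) *\<^sub>R bond_dir y x = 0" if "norm x + \<epsilon> < norm y" for y
      using weight_far[of y x] norm_triangle_sub[of y x] that by simp
  qed measurable
  then have "(\<integral>y. (weight x y * s y) *\<^sub>R bond_dir y x \<partial>lborel) \<bullet> w =
      (\<integral>y. ((weight x y * s y) *\<^sub>R bond_dir y x) \<bullet> w \<partial>lborel)"
    by (intro integral_inner_left[symmetric])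
  moreover have "(LINT y:ball x \<epsilon>|lborel. (weight x y * s y) *\<^sub>R bond_dir y x) =
      (\<integral>y. (weight x y * s y) *\<^sub>R bond_dir y x \<partial>lborel)"
    by (rule set_integral_eq_integral)
      (auto simp: dist_norm norm_minus_commute J_eps_far)
  ultimately show ?thesis by (simp add: mult.assoc)
qed

lemma abs_hydro_integrand_le:
  assumes L: "L-lipschitz_on UNIV u"
  shows "\<bar>\<omega> y * J_eps \<epsilon> J (norm (y - x)) * bond_strain u y x * norm (y - x)\<bar> \<le> M * L * \<epsilon>"
proof (cases "norm (y - x) < \<epsilon>")
  case True
  have "\<omega> y * J_eps \<epsilon> J (norm (y - x)) \<le> 1 * M"
    using \<omega>_range J_eps_range by (intro mult_mono) auto
  then have "\<bar>\<omega> y * J_eps \<epsilon> J (norm (y - x))\<bar> \<le> M"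
    using \<omega>_range J_eps_range by simp
  then have "\<bar>\<omega> y * J_eps \<epsilon> J (norm (y - x))\<bar> * \<bar>bond_strain u y x\<bar> * \<bar>norm (y - x)\<bar>
      \<le> M * L * \<epsilon>"
    using True abs_bond_strain_le[OF L, of y x] M_nonneg lipschitz_on_nonneg[OF L]
    by (intro mult_mono) auto
  then show ?thesis by (simp add: abs_mult)
qed (use J_eps_far M_nonneg horizon_pos lipschitz_on_nonneg[OF L] in auto)

lemma hydro_strain_integrable:
  assumes "u \<in> compact_lipschitz"
  shows "integrable lborel (\<lambda>y. \<omega> y * J_eps \<epsilon> J (norm (y - x)) * bond_strain u y x * norm (y - x))"
    (is "integrable lborel ?h")
proof -
  have [measurable]: "u \<in> borel_measurable borel"
    by (rule compact_lipschitz_measurable[OF assms])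
  obtain L where L: "L-lipschitz_on UNIV u"
    using assms unfolding compact_lipschitz_def by blast
  show ?thesis
  proof (rule integrable_bounded_support[where B = "M * L * \<epsilon>" and R = "norm x + \<epsilon>"])
    show "?h \<in> borel_measurable lborel" by measurable
    show "norm (?h y) \<le> M * L * \<epsilon>" for y
      using abs_hydro_integrand_le[OF L] by simp
    show "?h y = 0" if "norm x + \<epsilon> < norm y" for y
      using J_eps_far[of "norm (y - x)"] norm_triangle_sub[of y x] that by simp
  qed
qed

lemma hydro_strain_eq:
  "\<theta> u x = (\<integral>y. \<omega> y * J_eps \<epsilon> J (norm (y - x)) * bond_strain u y x * norm (y - x) \<partial>lborel) /
    (\<epsilon> ^ DIM('a) * vol_unit_ball TYPE('a))"
proof -
  have "(LINT y:ball x \<epsilon>|lborel. \<omega> y * J_eps \<epsilon> J (norm (y - x)) * bond_strain u y x * norm (y - x)) =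
    (\<integral>y. \<omega> y * J_eps \<epsilon> J (norm (y - x)) * bond_strain u y x * norm (y - x) \<partial>lborel)"
    by (rule set_integral_eq_integral) (auto simp: dist_norm norm_minus_commute J_eps_far)
  then show ?thesis unfolding hydro_strain_def by simp
qed

lemma hydro_strain_integral:
  "(\<integral>y. \<omega> y * J_eps \<epsilon> J (norm (y - x)) * bond_strain u y x * norm (y - x) \<partial>lborel) =
    (\<epsilon> ^ DIM('a) * vol_unit_ball TYPE('a)) * \<theta> u x"
proof -
  have "I = V * (I / V)" if "V \<noteq> 0" for I V :: real
    using that by simp
  then show ?thesis
    unfolding hydro_strain_eq by this (rule less_imp_neq[OF horizon_volume_pos, symmetric])
qed

lemma hydro_strain_linear:
  assumes "u \<in> compact_lipschitz" "v \<in> compact_lipschitz"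
  shows "\<theta> (\<lambda>x. \<alpha> *\<^sub>R u x + \<beta> *\<^sub>R v x) x = \<alpha> * \<theta> u x + \<beta> * \<theta> v x"
proof -
  let ?h = "\<lambda>u y. \<omega> y * J_eps \<epsilon> J (norm (y - x)) * bond_strain u y x * norm (y - x)"
  have "(\<integral>y. ?h (\<lambda>x. \<alpha> *\<^sub>R u x + \<beta> *\<^sub>R v x) y \<partial>lborel) = (\<integral>y. \<alpha> * ?h u y + \<beta> * ?h v y \<partial>lborel)"
    by (simp add: bond_strain_linear algebra_simps)
  also have "\<dots> = \<alpha> * integral\<^sup>L lborel (?h u) + \<beta> * integral\<^sup>L lborel (?h v)"
    using hydro_strain_integrable[OF assms(1)] hydro_strain_integrable[OF assms(2)] by simp
  finally show ?thesis unfolding hydro_strain_eq by (simp add: add_divide_distrib)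
qed

lemma hydro_strain_measurable:
  assumes "u \<in> compact_lipschitz"
  shows "\<theta> u \<in> borel_measurable borel"
proof -
  have [measurable]: "u \<in> borel_measurable borel"
    by (rule compact_lipschitz_measurable[OF assms])
  have "(\<lambda>x. (\<integral>y. \<omega> y * J_eps \<epsilon> J (norm (y - x)) * bond_strain u y x * norm (y - x) \<partial>lborel) /
      (\<epsilon> ^ DIM('a) * vol_unit_ball TYPE('a)))
      \<in> borel_measurable borel"
    by measurable
  then show ?thesis unfolding hydro_strain_eq[abs_def] .
qed

text \<open>The support grows by at most the horizon \<open>\<epsilon>\<close>. The bound is uniform in \<open>x\<close> because all balls of
  radius \<open>\<epsilon>\<close> have the same volume.\<close>

lemma hydro_strain_bounded:
  assumes u: "u \<in> compact_lipschitz"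
  shows "\<exists>B. \<forall>x. \<bar>\<theta> u x\<bar> \<le> B" "\<exists>R. \<forall>x. R < norm x \<longrightarrow> \<theta> u x = 0"
proof -
  obtain L R where L: "L-lipschitz_on UNIV u" and R: "\<And>x. R < norm x \<Longrightarrow> u x = 0"
    using u unfolding compact_lipschitz_def by blast
  let ?h = "\<lambda>x y. \<omega> y * J_eps \<epsilon> J (norm (y - x)) * bond_strain u y x * norm (y - x)"
  let ?B = "(M * L * \<epsilon>) * (unit_ball_vol (real DIM('a)) * \<epsilon> ^ DIM('a)) / (\<epsilon> ^ DIM('a) * vol_unit_ball TYPE('a))"
  have "\<bar>\<theta> u x\<bar> \<le> ?B" for x
  proof -
    have "norm (integral\<^sup>L lborel (?h x)) \<le> (\<integral>y. (M * L * \<epsilon>) * indicator (ball x \<epsilon>) y \<partial>lborel)"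
    proof (rule Bochner_Integration.integral_norm_bound_integral)
      show "integrable lborel (?h x)" by (rule hydro_strain_integrable[OF u])
      show "integrable lborel (\<lambda>y. (M * L * \<epsilon>) * indicator (ball x \<epsilon>) y)"
        using emeasure_lborel_ball_finite[of x \<epsilon>] by (intro integrable_mult_right) auto
      show "norm (?h x y) \<le> (M * L * \<epsilon>) * indicator (ball x \<epsilon>) y" for y
        using abs_hydro_integrand_le[OF L, of y x] J_eps_far[of "norm (y - x)"]
        by (auto simp: indicator_def dist_norm norm_minus_commute)
    qed
    also have "\<dots> = (M * L * \<epsilon>) * (unit_ball_vol (real DIM('a)) * \<epsilon> ^ DIM('a))"
      using content_ball[of \<epsilon> x] horizon_pos by simp
    finally show ?thesis
      unfolding hydro_strain_eq abs_divide abs_of_pos[OF horizon_volume_pos] real_norm_def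
      by (intro divide_right_mono less_imp_le[OF horizon_volume_pos])
  qed
  then show "\<exists>B. \<forall>x. \<bar>\<theta> u x\<bar> \<le> B" by blast
  have "\<theta> u x = 0" if "R + \<epsilon> < norm x" for x
  proof -
    have "?h x y = 0" for y
    proof (cases "norm (y - x) < \<epsilon>")
      case True
      then have "R < norm x" "R < norm y"
        using that horizon_pos norm_triangle_sub[of x y] by (simp_all add: norm_minus_commute)
      then show ?thesis using R by (simp add: bond_strain_def)
    qed (use J_eps_far in auto)
    then have "?h x = (\<lambda>_. 0)" by (rule ext)
    then show ?thesis unfolding hydro_strain_eq by (simp only: integral_zero div_0)
  qed
  then show "\<exists>R. \<forall>x. R < norm x \<longrightarrow> \<theta> u x = 0" by blast
qed

lemma bond_force_integrable:
  assumes v: "v \<in> compact_lipschitz"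
    and s: "(\<lambda>(x, y). s x y) \<in> borel_measurable (lborel \<Otimes>\<^sub>M lborel)"
    and bound: "\<And>x y. \<bar>s x y\<bar> \<le> C"
  shows "integrable (lborel \<Otimes>\<^sub>M lborel) (\<lambda>(x, y). weight x y * (s x y * (bond_dir y x \<bullet> v x)))"
proof -
  have [measurable]: "v \<in> borel_measurable borel"
    by (rule compact_lipschitz_measurable[OF v])
  have s' [measurable]: "(\<lambda>z. s (fst z) (snd z)) \<in> borel_measurable (lborel \<Otimes>\<^sub>M lborel)"
    using s by (simp add: case_prod_unfold)
  obtain B where B: "\<And>x. norm (v x) \<le> B"
    using compact_lipschitz_bounded(1)[OF v] by blast
  obtain R where R: "\<And>x. R < norm x \<Longrightarrow> v x = 0"
    using compact_lipschitz_bounded(2)[OF v] by blast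
  show ?thesis
  proof (rule integrable_bond_pairs[where C = "C * B" and R = R])
    show "(\<lambda>(x, y). s x y * (bond_dir y x \<bullet> v x)) \<in> borel_measurable (lborel \<Otimes>\<^sub>M lborel)"
      unfolding case_prod_unfold by measurable
    show "\<bar>s x y * (bond_dir y x \<bullet> v x)\<bar> \<le> C * B" for x y
    proof -
      have "\<bar>bond_dir y x \<bullet> v x\<bar> \<le> norm (bond_dir y x) * norm (v x)"
        by (rule Cauchy_Schwarz_ineq2)
      also have "\<dots> \<le> 1 * B"
        using norm_bond_dir_le B by (intro mult_mono) auto
      finally have "\<bar>bond_dir y x \<bullet> v x\<bar> \<le> B" by simp
      then show ?thesis
        unfolding abs_mult using bound[of x y] by (intro mult_mono) auto
    qed
  qed (use R in simp)
qed

lemma strain_pair_integrable: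
  assumes v: "v \<in> compact_lipschitz"
    and s: "(\<lambda>(x, y). s x y) \<in> borel_measurable (lborel \<Otimes>\<^sub>M lborel)"
    and bound: "\<And>x y. \<bar>s x y\<bar> \<le> C"
  shows "integrable (lborel \<Otimes>\<^sub>M lborel)
    (\<lambda>(x, y). weight x y * (s x y * (bond_strain v y x * norm (y - x))))"
proof -
  have [measurable]: "v \<in> borel_measurable borel"
    by (rule compact_lipschitz_measurable[OF v])
  have s' [measurable]: "(\<lambda>z. s (fst z) (snd z)) \<in> borel_measurable (lborel \<Otimes>\<^sub>M lborel)"
    using s by (simp add: case_prod_unfold)
  obtain L R where L: "L-lipschitz_on UNIV v" and R: "\<And>x. R < norm x \<Longrightarrow> v x = 0"
    using v unfolding compact_lipschitz_def by blast
  show ?thesis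
  proof (rule integrable_bond_pairs[where C = "C * (L * \<epsilon>)" and R = "R + \<epsilon>"])
    show "(\<lambda>(x, y). s x y * (bond_strain v y x * norm (y - x))) \<in> borel_measurable (lborel \<Otimes>\<^sub>M lborel)"
      unfolding case_prod_unfold by measurable
    show "\<bar>s x y * (bond_strain v y x * norm (y - x))\<bar> \<le> C * (L * \<epsilon>)" if "norm (y - x) < \<epsilon>" for x y
      unfolding abs_mult
      using bound[of x y] abs_bond_strain_le[OF L, of y x] lipschitz_on_nonneg[OF L] that
      by (intro mult_mono mult_nonneg_nonneg) auto
    show "s x y * (bond_strain v y x * norm (y - x)) = 0"
      if "norm (y - x) < \<epsilon>" "R + \<epsilon> < norm x" for x y
    proof -
      have "R < norm x" "R < norm y"
        using that horizon_pos norm_triangle_sub[of x y] by (simp_all add: norm_minus_commute)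
      then show ?thesis using R by (simp add: bond_strain_def)
    qed
  qed
qed

lemma bond_strain_bounded_measurable:
  assumes u: "u \<in> compact_lipschitz"
  shows "\<exists>C. \<forall>x y. \<bar>bond_strain u y x\<bar> \<le> C"
    "(\<lambda>(x, y). bond_strain u y x) \<in> borel_measurable (lborel \<Otimes>\<^sub>M lborel)"
proof -
  have [measurable]: "u \<in> borel_measurable borel"
    by (rule compact_lipschitz_measurable[OF u])
  show "(\<lambda>(x, y). bond_strain u y x) \<in> borel_measurable (lborel \<Otimes>\<^sub>M lborel)"
    unfolding case_prod_unfold by measurable
  show "\<exists>C. \<forall>x y. \<bar>bond_strain u y x\<bar> \<le> C"
    using u abs_bond_strain_le unfolding compact_lipschitz_def by blast
qed

text \<open>In both bilinear forms the factor \<open>\<omega>\<close>, which is 0 outside \<open>D\<close>, allows integration over the whole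
  space instead of \<open>D\<close>. That makes the domain of the double integrals symmetric.\<close>

lemma bilin_T_eq:
  "bilin_T D \<epsilon> J \<omega> f u v = (deriv ^^ 2) f 0 / (\<epsilon> ^ (DIM('a) + 1) * vol_unit_ball TYPE('a)) *
    (\<integral>x. \<integral>y. weight x y * (bond_strain u y x * (bond_strain v y x * norm (y - x))) \<partial>lborel \<partial>lborel)"
proof -
  have "(LINT y:D|lborel. weight x y * norm (y - x) * bond_strain u y x * bond_strain v y x) =
      (\<integral>y. weight x y * (bond_strain u y x * (bond_strain v y x * norm (y - x))) \<partial>lborel)" for x
    by (subst set_integral_eq_integral) (simp_all add: \<omega>_outside mult_ac)
  then show ?thesis
    unfolding bilin_T_def by (simp, subst set_integral_eq_integral) (simp_all add: \<omega>_outside)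
qed

lemma bilin_D_eq:
  "bilin_D D \<epsilon> J \<omega> g u v = (deriv ^^ 2) g 0 / \<epsilon>\<^sup>2 * (\<integral>x. \<omega> x * \<theta> u x * \<theta> v x \<partial>lborel)"
  unfolding bilin_D_def by (subst set_integral_eq_integral) (simp_all add: \<omega>_outside)

lemma force_T_inner:
  assumes "u \<in> compact_lipschitz"
  shows "force_T \<epsilon> J \<omega> f u x \<bullet> w =
    2 * (deriv ^^ 2) f 0 / (\<epsilon> ^ (DIM('a) + 1) * vol_unit_ball TYPE('a)) *
    (\<integral>y. weight x y * (bond_strain u y x * (bond_dir y x \<bullet> w)) \<partial>lborel)"
proof -
  have [measurable]: "u \<in> borel_measurable borel"
    by (rule compact_lipschitz_measurable[OF assms])
  obtain C where "\<And>y. \<bar>bond_strain u y x\<bar> \<le> C"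
    using bond_strain_bounded_measurable(1)[OF assms] by blast
  then have C: "\<bar>(deriv ^^ 2) f 0 * bond_strain u y x\<bar> \<le> \<bar>(deriv ^^ 2) f 0\<bar> * C" for y
    unfolding abs_mult by (intro mult_left_mono) auto
  have "(LINT y:ball x \<epsilon>|lborel. (weight x y * (deriv ^^ 2) f 0 * bond_strain u y x) *\<^sub>R bond_dir y x) \<bullet> w
      = (\<integral>y. (deriv ^^ 2) f 0 * (weight x y * (bond_strain u y x * (bond_dir y x \<bullet> w))) \<partial>lborel)"
    using ball_integral_inner[where s = "\<lambda>y. (deriv ^^ 2) f 0 * bond_strain u y x",
        OF _ C, where x = x and w = w]
    by (simp add: mult.assoc mult.left_commute)
  then show ?thesis unfolding force_T_def by simp
qed

lemma force_D_inner:
  assumes "u \<in> compact_lipschitz"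
  shows "force_D \<epsilon> J \<omega> g u x \<bullet> w =
    (deriv ^^ 2) g 0 / (\<epsilon> ^ (DIM('a) + 2) * vol_unit_ball TYPE('a)) *
    (\<integral>y. weight x y * ((\<theta> u y + \<theta> u x) * (bond_dir y x \<bullet> w)) \<partial>lborel)"
proof -
  have [measurable]: "\<theta> u \<in> borel_measurable borel"
    by (rule hydro_strain_measurable[OF assms])
  obtain B where B: "\<And>x. \<bar>\<theta> u x\<bar> \<le> B"
    using hydro_strain_bounded(1)[OF assms] by blast
  have "\<bar>\<theta> u y + \<theta> u x\<bar> \<le> 2 * B" for y
    using B[of x] B[of y] by linarith
  then have "(LINT y:ball x \<epsilon>|lborel. (weight x y * (\<theta> u y + \<theta> u x)) *\<^sub>R bond_dir y x) \<bullet> w =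
      (\<integral>y. weight x y * ((\<theta> u y + \<theta> u x) * (bond_dir y x \<bullet> w)) \<partial>lborel)"
    by (intro ball_integral_inner) measurable
  then show ?thesis
    unfolding force_D_def inner_scaleR_left by (simp only:)
qed

text \<open>\<open>T\<close> and \<open>P\<close> are the integrands of the tensile and the dilatational force tested with \<open>v\<close>; \<open>T'\<close> and
  \<open>P'\<close> those of the bilinear forms. The sum of \<open>T\<close> over both orientations of a bond is \<open>-T'\<close>, which gives
  the factor \<open>-1/2\<close> that cancels the 2 in the tensile force. For \<open>P\<close>, the symmetric sum
  \<open>\<theta>(y) + \<theta>(x)\<close> is shared out to the two orientations of \<open>P'\<close>, and the inner integral of \<open>P'\<close> is by
  definition a multiple of the hydrostatic strain of \<open>v\<close>.\<close>

theorem force_weak_form: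
  assumes u: "u \<in> compact_lipschitz" and v: "v \<in> compact_lipschitz"
  shows "L2_inner D (force \<epsilon> J \<omega> f g u) v = - bilin D \<epsilon> J \<omega> f g u v"
proof -
  let ?c = "(deriv ^^ 2) f 0 / (\<epsilon> ^ (DIM('a) + 1) * vol_unit_ball TYPE('a))"
  let ?d = "(deriv ^^ 2) g 0 / (\<epsilon> ^ (DIM('a) + 2) * vol_unit_ball TYPE('a))"
  define T where "T x y = weight x y * (bond_strain u y x * (bond_dir y x \<bullet> v x))" for x y
  define P where "P x y = weight x y * ((\<theta> u y + \<theta> u x) * (bond_dir y x \<bullet> v x))" for x y
  define T' where "T' x y = weight x y * (bond_strain u y x * (bond_strain v y x * norm (y - x)))" for x y
  define P' where "P' x y = weight x y * (\<theta> u x * (bond_strain v y x * norm (y - x)))" for x y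
  have [measurable]: "\<theta> u \<in> borel_measurable borel"
    by (rule hydro_strain_measurable[OF u])
  obtain B where B: "\<And>x. \<bar>\<theta> u x\<bar> \<le> B"
    using hydro_strain_bounded(1)[OF u] by blast
  obtain C where C: "\<And>x y. \<bar>bond_strain u y x\<bar> \<le> C"
    using bond_strain_bounded_measurable(1)[OF u] by blast
  have T: "integrable (lborel \<Otimes>\<^sub>M lborel) (\<lambda>(x, y). T x y)"
    unfolding T_def by (rule bond_force_integrable[OF v bond_strain_bounded_measurable(2)[OF u] C])
  have T': "integrable (lborel \<Otimes>\<^sub>M lborel) (\<lambda>(x, y). T' x y)"
    unfolding T'_def by (rule strain_pair_integrable[OF v bond_strain_bounded_measurable(2)[OF u] C])
  have P: "integrable (lborel \<Otimes>\<^sub>M lborel) (\<lambda>(x, y). P x y)"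
    unfolding P_def
  proof (rule bond_force_integrable[OF v])
    show "\<bar>\<theta> u y + \<theta> u x\<bar> \<le> 2 * B" for x y
      using B[of x] B[of y] by linarith
  qed measurable
  have P': "integrable (lborel \<Otimes>\<^sub>M lborel) (\<lambda>(x, y). P' x y)"
    unfolding P'_def by (rule strain_pair_integrable[OF v _ B]) measurable
  have antisym: "bond_dir y x \<bullet> v x + bond_dir x y \<bullet> v y = - (bond_strain v y x * norm (y - x))" for x y
    unfolding bond_strain_times_norm bond_dir_commute[of x y]
    by (simp add: inner_diff_left inner_commute[of "bond_dir y x"])
  have T_sym: "T x y + T y x = - T' x y" for x y
  proof -
    have "T x y + T y x =
        weight x y * (bond_strain u y x * (bond_dir y x \<bullet> v x + bond_dir x y \<bullet> v y))"
      unfolding T_def weight_commute[of x y] bond_strain_commute[of u x y]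
      by (simp add: distrib_left)
    then show ?thesis unfolding antisym T'_def by simp
  qed
  have T'_sym: "T' y x = T' x y" for x y
    unfolding T'_def weight_commute[of x y] bond_strain_commute[of _ x y]
    by (simp add: norm_minus_commute)
  have P_sym: "P x y + P y x = - P' x y - P' y x" for x y
  proof -
    have "P x y + P y x =
        weight x y * ((\<theta> u y + \<theta> u x) * (bond_dir y x \<bullet> v x + bond_dir x y \<bullet> v y))"
      unfolding P_def weight_commute[of x y] by (simp add: algebra_simps)
    moreover have "P' x y + P' y x =
        weight x y * ((\<theta> u y + \<theta> u x) * (bond_strain v y x * norm (y - x)))"
      unfolding P'_def weight_commute[of x y] bond_strain_commute[of v x y]
        norm_minus_commute[of x y]
      by (simp add: algebra_simps)
    ultimately show ?thesis unfolding antisym by simp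
  qed
  have "(\<integral>x. \<integral>y. T x y \<partial>lborel \<partial>lborel) = (\<integral>x. \<integral>y. (-1/2) * T' x y \<partial>lborel \<partial>lborel)"
  proof (rule integral_double_symmetrize_cong[OF T])
    show "integrable (lborel \<Otimes>\<^sub>M lborel) (\<lambda>(x, y). (-1/2) * T' x y)"
      using integrable_mult_right[OF T', of "-1/2"] by (simp add: case_prod_unfold)
  qed (simp add: T_sym T'_sym)
  then have int_T: "(\<integral>x. \<integral>y. T x y \<partial>lborel \<partial>lborel) = - (\<integral>x. \<integral>y. T' x y \<partial>lborel \<partial>lborel) / 2"
    by simp
  have "(\<integral>x. \<integral>y. P x y \<partial>lborel \<partial>lborel) = (\<integral>x. \<integral>y. - P' x y \<partial>lborel \<partial>lborel)"
  proof (rule integral_double_symmetrize_cong[OF P])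
    show "integrable (lborel \<Otimes>\<^sub>M lborel) (\<lambda>(x, y). - P' x y)"
      using integrable_mult_right[OF P', of "-1"] by (simp add: case_prod_unfold)
  qed (simp add: P_sym)
  also have "\<dots> = - (\<integral>x. \<integral>y. P' x y \<partial>lborel \<partial>lborel)" by simp
  also have "(\<lambda>x. \<integral>y. P' x y \<partial>lborel) =
      (\<lambda>x. (\<epsilon> ^ DIM('a) * vol_unit_ball TYPE('a)) * (\<omega> x * \<theta> u x * \<theta> v x))"
  proof
    fix x
    have "(\<integral>y. P' x y \<partial>lborel) = (\<integral>y. (\<omega> x * \<theta> u x) *
        (\<omega> y * J_eps \<epsilon> J (norm (y - x)) * bond_strain v y x * norm (y - x)) \<partial>lborel)"
      unfolding P'_def by (simp add: mult_ac)
    also have "\<dots> = (\<omega> x * \<theta> u x) *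
        (\<integral>y. \<omega> y * J_eps \<epsilon> J (norm (y - x)) * bond_strain v y x * norm (y - x) \<partial>lborel)"
      by (rule integral_mult_right_zero)
    also have "(\<integral>y. \<omega> y * J_eps \<epsilon> J (norm (y - x)) * bond_strain v y x * norm (y - x) \<partial>lborel) =
        (\<epsilon> ^ DIM('a) * vol_unit_ball TYPE('a)) * \<theta> v x"
      by (rule hydro_strain_integral)
    finally show "(\<integral>y. P' x y \<partial>lborel) =
        (\<epsilon> ^ DIM('a) * vol_unit_ball TYPE('a)) * (\<omega> x * \<theta> u x * \<theta> v x)"
      by simp
  qed
  finally have int_P: "(\<integral>x. \<integral>y. P x y \<partial>lborel \<partial>lborel) =
      - ((\<epsilon> ^ DIM('a) * vol_unit_ball TYPE('a)) * (\<integral>x. \<omega> x * \<theta> u x * \<theta> v x \<partial>lborel))"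
    by simp
  have vol_nonzero: "vol_unit_ball TYPE('a) \<noteq> 0"
    using horizon_volume_pos by auto
  have inner: "force \<epsilon> J \<omega> f g u x \<bullet> v x =
      2 * ?c * (\<integral>y. T x y \<partial>lborel) + ?d * (\<integral>y. P x y \<partial>lborel)" for x
    unfolding force_def inner_add_left force_T_inner[OF u] force_D_inner[OF u] T_def P_def by simp
  have "L2_inner D (force \<epsilon> J \<omega> f g u) v = (\<integral>x. force \<epsilon> J \<omega> f g u x \<bullet> v x \<partial>lborel)"
    unfolding L2_inner_def
    by (rule set_integral_eq_integral) (simp add: inner T_def P_def \<omega>_outside)
  also have "\<dots> = 2 * ?c * (\<integral>x. \<integral>y. T x y \<partial>lborel \<partial>lborel) + ?d * (\<integral>x. \<integral>y. P x y \<partial>lborel \<partial>lborel)"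
    unfolding inner
    using lborel_pair.integrable_fst'[OF T] lborel_pair.integrable_fst'[OF P] by simp
  also have "\<dots> = - bilin D \<epsilon> J \<omega> f g u v"
    using horizon_pos vol_nonzero unfolding int_T int_P bilin_def bilin_T_eq bilin_D_eq T'_def
    by (simp add: field_simps power2_eq_square)
  finally show ?thesis .
qed

lemma symmetric_bilinear_on_bilin:
  "symmetric_bilinear_on compact_lipschitz (bilin D \<epsilon> J \<omega> f g)"
  unfolding symmetric_bilinear_on_def
proof (intro conjI ballI allI)
  fix u v :: "'a \<Rightarrow> 'a" assume u: "u \<in> compact_lipschitz" and v: "v \<in> compact_lipschitz"
  show "bilin D \<epsilon> J \<omega> f g u v = bilin D \<epsilon> J \<omega> f g v u"
    unfolding bilin_def bilin_T_eq bilin_D_eq by (simp add: mult_ac)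
  fix w :: "'a \<Rightarrow> 'a" and \<alpha> \<beta> :: real assume w: "w \<in> compact_lipschitz"
  let ?c = "\<lambda>x. \<alpha> *\<^sub>R u x + \<beta> *\<^sub>R v x"
  let ?T = "\<lambda>u x y. weight x y * (bond_strain u y x * (bond_strain w y x * norm (y - x)))"
  have T: "integrable (lborel \<Otimes>\<^sub>M lborel) (\<lambda>(x, y). ?T u x y)" if "u \<in> compact_lipschitz" for u
    using strain_pair_integrable[OF w bond_strain_bounded_measurable(2)[OF that]]
      bond_strain_bounded_measurable(1)[OF that] by blast
  have "(\<integral>x. \<integral>y. ?T ?c x y \<partial>lborel \<partial>lborel) = (\<integral>x. \<integral>y. \<alpha> * ?T u x y + \<beta> * ?T v x y \<partial>lborel \<partial>lborel)"
    by (simp add: bond_strain_linear algebra_simps)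
  also have "\<dots> = \<alpha> * (\<integral>x. \<integral>y. ?T u x y \<partial>lborel \<partial>lborel) + \<beta> * (\<integral>x. \<integral>y. ?T v x y \<partial>lborel \<partial>lborel)"
    by (rule integral_double_lin[OF T[OF u] T[OF v]])
  finally have T_lin: "(\<integral>x. \<integral>y. ?T ?c x y \<partial>lborel \<partial>lborel) =
    \<alpha> * (\<integral>x. \<integral>y. ?T u x y \<partial>lborel \<partial>lborel) + \<beta> * (\<integral>x. \<integral>y. ?T v x y \<partial>lborel \<partial>lborel)" .
  have \<theta>: "integrable lborel (\<lambda>x. \<omega> x * \<theta> u x * \<theta> w x)" if u: "u \<in> compact_lipschitz" for u
  proof -
    have [measurable]: "\<theta> u \<in> borel_measurable borel" "\<theta> w \<in> borel_measurable borel"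
      using hydro_strain_measurable u w by auto
    obtain B where B: "\<And>x. \<bar>\<theta> u x\<bar> \<le> B"
      using hydro_strain_bounded(1)[OF u] by blast
    obtain C where C: "\<And>x. \<bar>\<theta> w x\<bar> \<le> C"
      using hydro_strain_bounded(1)[OF w] by blast
    obtain R where R: "\<And>x. R < norm x \<Longrightarrow> \<theta> w x = 0"
      using hydro_strain_bounded(2)[OF w] by blast
    show ?thesis
    proof (rule integrable_bounded_support)
      show "norm (\<omega> x * \<theta> u x * \<theta> w x) \<le> 1 * B * C" for x
        unfolding norm_mult
        using \<omega>_range B[of x] C[of x] by (intro mult_mono mult_nonneg_nonneg) auto
      show "\<omega> x * \<theta> u x * \<theta> w x = 0" if "R < norm x" for x using R[OF that] by simp
    qed measurable
  qed
  have "(\<integral>x. \<omega> x * \<theta> ?c x * \<theta> w x \<partial>lborel) =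
      (\<integral>x. \<alpha> * (\<omega> x * \<theta> u x * \<theta> w x) + \<beta> * (\<omega> x * \<theta> v x * \<theta> w x) \<partial>lborel)"
    by (simp add: hydro_strain_linear[OF u v] algebra_simps)
  also have "\<dots> = \<alpha> * (\<integral>x. \<omega> x * \<theta> u x * \<theta> w x \<partial>lborel) + \<beta> * (\<integral>x. \<omega> x * \<theta> v x * \<theta> w x \<partial>lborel)"
    using \<theta>[OF u] \<theta>[OF v] by simp
  finally have \<theta>_lin: "(\<integral>x. \<omega> x * \<theta> ?c x * \<theta> w x \<partial>lborel) =
    \<alpha> * (\<integral>x. \<omega> x * \<theta> u x * \<theta> w x \<partial>lborel) + \<beta> * (\<integral>x. \<omega> x * \<theta> v x * \<theta> w x \<partial>lborel)" .
  show "bilin D \<epsilon> J \<omega> f g ?c w = \<alpha> * bilin D \<epsilon> J \<omega> f g u w + \<beta> * bilin D \<epsilon> J \<omega> f g v w"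
    unfolding bilin_def bilin_T_eq bilin_D_eq T_lin \<theta>_lin by (simp only: algebra_simps)
qed

lemma bilin_nonneg:
  assumes f: "0 \<le> (deriv ^^ 2) f 0" and g: "0 \<le> (deriv ^^ 2) g 0"
  shows "0 \<le> bilin D \<epsilon> J \<omega> f g u u"
proof -
  have "0 \<le> weight x y * (bond_strain u y x * (bond_strain u y x * norm (y - x)))" for x y
    unfolding mult.assoc[of "bond_strain u y x" "bond_strain u y x", symmetric]
    by (rule mult_nonneg_nonneg[OF weight_nonneg]) simp
  then have "0 \<le> bilin_T D \<epsilon> J \<omega> f u u"
    unfolding bilin_T_eq using f horizon_pos horizon_volume_pos
    by (intro mult_nonneg_nonneg divide_nonneg_nonneg integral_nonneg) (auto simp: zero_less_mult_iff)
  moreover have "0 \<le> bilin_D D \<epsilon> J \<omega> g u u"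
    unfolding bilin_D_eq using g \<omega>_range
    by (intro mult_nonneg_nonneg divide_nonneg_nonneg integral_nonneg) (simp_all add: mult.assoc)
  ultimately show ?thesis by (simp add: bilin_def)
qed

lemma L2_inner_integrable:
  fixes u v :: "'a \<Rightarrow> 'a"
  assumes u: "u \<in> compact_lipschitz" and v: "v \<in> compact_lipschitz"
  shows "set_integrable lborel D (\<lambda>x. u x \<bullet> v x)"
proof -
  have [measurable]: "u \<in> borel_measurable borel" "v \<in> borel_measurable borel"
    using u v by (simp_all add: compact_lipschitz_measurable)
  obtain B where B: "\<And>x. norm (u x) \<le> B"
    using compact_lipschitz_bounded(1)[OF u] by blast
  obtain R where R: "\<And>x. R < norm x \<Longrightarrow> u x = 0"
    using compact_lipschitz_bounded(2)[OF u] by blast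
  obtain C where C: "\<And>x. norm (v x) \<le> C"
    using compact_lipschitz_bounded(1)[OF v] by blast
  have "integrable lborel (\<lambda>x. u x \<bullet> v x)"
  proof (rule integrable_bounded_support)
    show "norm (u x \<bullet> v x) \<le> B * C" for x
    proof -
      have "norm (u x \<bullet> v x) \<le> norm (u x) * norm (v x)"
        using Cauchy_Schwarz_ineq2 by simp
      also have "\<dots> \<le> B * C" 
        using B[of x] C[of x] order_trans[OF norm_ge_zero B] by (intro mult_mono) auto
      finally show ?thesis .
    qed
    show "u x \<bullet> v x = 0" if "R < norm x" for x using R[OF that] by simp
  qed measurable
  then show ?thesis
    unfolding set_integrable_def by (intro integrable_mult_indicator) auto
qed

lemma symmetric_bilinear_on_L2_inner:
  "symmetric_bilinear_on compact_lipschitz (L2_inner D)"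
  unfolding symmetric_bilinear_on_def
proof (intro conjI ballI allI)
  fix u v :: "'a \<Rightarrow> 'a" assume u: "u \<in> compact_lipschitz" and v: "v \<in> compact_lipschitz"
  show "L2_inner D u v = L2_inner D v u"
    unfolding L2_inner_def by (simp add: inner_commute)
  fix w :: "'a \<Rightarrow> 'a" and \<alpha> \<beta> :: real assume w: "w \<in> compact_lipschitz"
  show "L2_inner D (\<lambda>x. \<alpha> *\<^sub>R u x + \<beta> *\<^sub>R v x) w = \<alpha> * L2_inner D u w + \<beta> * L2_inner D v w"
    using L2_inner_integrable[OF u w] L2_inner_integrable[OF v w]
    unfolding L2_inner_def by (simp add: inner_add_left set_integral_add)
qed

lemma L2_inner_pos:
  assumes w: "w \<in> compact_lipschitz" and zero: "\<And>x. x \<notin> D \<Longrightarrow> w x = 0" and "w \<noteq> (\<lambda>_. 0)"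
  shows "0 < L2_inner D w w"
proof -
  have "(\<lambda>x. indicator D x *\<^sub>R (w x \<bullet> w x)) = (\<lambda>x. (norm (w x))\<^sup>2)"
    using zero by (auto simp: fun_eq_iff indicator_def power2_norm_eq_inner)
  then have "integrable lborel (\<lambda>x. (norm (w x))\<^sup>2)" "L2_inner D w w = (\<integral>x. (norm (w x))\<^sup>2 \<partial>lborel)"
    using L2_inner_integrable[OF w w]
    by (simp_all add: set_integrable_def L2_inner_def set_lebesgue_integral_def)
  moreover have "continuous_on UNIV w"
    using w lipschitz_on_continuous_on unfolding compact_lipschitz_def by blast
  ultimately show ?thesis using continuous_integral_norm_pos[of w] assms(3) by simp
qed

end

section \<open>The load and the CFL condition\<close>

lemma L2_inner_zero_AE:
  assumes "in_L2 D b" "AE x\<in>D in lborel. b x = 0"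
    and [measurable]: "v \<in> borel_measurable borel" "D \<in> sets borel"
  shows "L2_inner D b v = 0"
proof -
  have [measurable]: "(\<lambda>x. indicator D x *\<^sub>R b x) \<in> borel_measurable lborel"
    using assms(1) unfolding in_L2_def set_borel_measurable_def by blast
  have "L2_inner D b v = (\<integral>x. (indicator D x *\<^sub>R b x) \<bullet> v x \<partial>lborel)"
    unfolding L2_inner_def set_lebesgue_integral_def by simp
  also have "\<dots> = (\<integral>x. 0 \<partial>(lborel :: 'a measure))"
  proof (rule integral_cong_AE)
    show "AE x in lborel. (indicator D x *\<^sub>R b x) \<bullet> v x = 0"
      using assms(2) by eventually_elim (simp add: indicator_def)
  qed measurable
  finally show ?thesis by simp
qed

text \<open>The supremum is taken in the extended reals, so a single quotient is below it even if the
  quotients are unbounded; in that case the hypothesis fails since \<open>c\<close> is positive.\<close>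

lemma CFL_bound:
  fixes a m :: "'b \<Rightarrow> real" and c :: real
  assumes CFL: "ereal c * (SUP w \<in> V - {z}. ereal (a w / m w)) \<le> 1"
    and c: "0 < c" and w: "w \<in> V" "w \<noteq> z" and m: "0 < m w"
  shows "c * a w \<le> m w"
proof -
  have "ereal (a w / m w) \<le> (SUP w \<in> V - {z}. ereal (a w / m w))"
    using w by (intro SUP_upper) simp
  then have "ereal c * ereal (a w / m w) \<le> ereal c * (SUP w \<in> V - {z}. ereal (a w / m w))"
    using c by (intro ereal_mult_left_mono) auto
  from order_trans[OF this CFL] have "c * (a w / m w) \<le> 1" by simp
  then show ?thesis using m by (simp add: divide_le_eq)
qed

section \<open>Stability\<close>

theorem theorem4p4:
  fixes D :: "(real ^ 'n) set"
    and \<epsilon> \<delta> M h \<sigma> \<Delta>t :: real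
    and J f g :: "real \<Rightarrow> real"
    and \<omega> :: "real ^ 'n \<Rightarrow> real"
    and \<T> :: "(real ^ 'n) set set"
    and Vh :: "(real ^ 'n \<Rightarrow> real ^ 'n) set"
    and u0 v0 vh0 :: "real ^ 'n \<Rightarrow> real ^ 'n"
    and b :: "real \<Rightarrow> real ^ 'n \<Rightarrow> real ^ 'n"
    and bh u :: "nat \<Rightarrow> real ^ 'n \<Rightarrow> real ^ 'n"
  assumes dim: "CARD('n) = 2 \<or> CARD('n) = 3"
    and domain: "open D" "C1_boundary D"
    and horizon: "\<epsilon> > 0"
    and influence: "influence_function M J"
    and boundary: "\<delta> > 0" "boundary_function D \<delta> \<omega>"
    and potentials: "potential f" "potential g"
    and mesh: "fe_mesh D h \<sigma> \<T>"
    and Vh: "Vh = fe_space D \<T>"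
    and step: "\<Delta>t > 0"
    and data: "in_L2 D u0" "in_L2 D v0" "\<And>t. t \<ge> 0 \<Longrightarrow> in_L2 D (b t)"
    and initial: "L2_projection D Vh u0 (u 0)" "L2_projection D Vh v0 vh0"
    and body: "\<And>k. L2_projection D Vh (b (real k * \<Delta>t)) (bh k)"
    and u_in: "\<And>k. u k \<in> Vh"
    and scheme: "central_difference_scheme D Vh (force \<epsilon> J \<omega> f g) \<Delta>t bh vh0 u"
    and no_body: "\<And>t. t \<ge> 0 \<Longrightarrow> AE x\<in>D in lborel. b t x = 0"
    and CFL: "ereal (\<Delta>t\<^sup>2 / 4) *
        (SUP w \<in> Vh - {\<lambda>_. 0}. ereal (bilin D \<epsilon> J \<omega> f g w w / L2_inner D w w)) \<le> 1"
  shows "\<forall>k. discrete_energy D (bilin D \<epsilon> J \<omega> f g) \<Delta>t u k \<ge> 0 \<and>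
    discrete_energy D (bilin D \<epsilon> J \<omega> f g) \<Delta>t u k =
      discrete_energy D (bilin D \<epsilon> J \<omega> f g) \<Delta>t u 0"
proof -
  interpret peridynamic_medium D \<epsilon> M J \<omega>
  proof
    show "\<omega> \<in> borel_measurable borel"
      using boundary(2) by (auto simp: boundary_function_def intro: borel_measurable_continuous_onI)
  qed (use domain horizon influence boundary in \<open>auto simp: boundary_function_def\<close>)
  let ?a = "bilin D \<epsilon> J \<omega> f g" and ?m = "L2_inner D"
  have V: "function_subspace Vh"
    unfolding Vh by (rule function_subspace_fe_space)
  have "triangulation \<T>"
    using mesh by (simp add: fe_mesh_def)
  then have lip: "Vh \<subseteq> compact_lipschitz"
    unfolding Vh by (rule fe_space_subset_compact_lipschitz)
  have m: "symmetric_bilinear_on Vh ?m"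
    by (rule symmetric_bilinear_on_subset[OF symmetric_bilinear_on_L2_inner lip])
  have a: "symmetric_bilinear_on Vh ?a"
    by (rule symmetric_bilinear_on_subset[OF symmetric_bilinear_on_bilin lip])
  have no_load: "?m (bh k) w = 0" if w: "w \<in> Vh" for k w
  proof -
    have t: "0 \<le> real k * \<Delta>t" using step by simp
    have "?m (bh k) w = ?m (b (real k * \<Delta>t)) w"
      using body[of k] w by (simp add: L2_projection_def)
    also have "\<dots> = 0"
      using w lip compact_lipschitz_measurable domain
      by (intro L2_inner_zero_AE data(3) no_body t) auto
    finally show ?thesis .
  qed
  have energy: "discrete_energy D ?a \<Delta>t u k = 1 / 2 *
      (?m (\<lambda>x. (u (Suc k) x - u k x) /\<^sub>R \<Delta>t) (\<lambda>x. (u (Suc k) x - u k x) /\<^sub>R \<Delta>t)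
        - \<Delta>t\<^sup>2 / 4 * ?a (\<lambda>x. (u (Suc k) x - u k x) /\<^sub>R \<Delta>t) (\<lambda>x. (u (Suc k) x - u k x) /\<^sub>R \<Delta>t)
        + ?a (\<lambda>x. (u (Suc k) x + u k x) /\<^sub>R 2) (\<lambda>x. (u (Suc k) x + u k x) /\<^sub>R 2))" for k
  proof -
    have "0 \<le> ?m w w" for w
      unfolding L2_inner_def set_lebesgue_integral_def by simp
    then show ?thesis
      by (simp add: discrete_energy_def time_diff_def[abs_def] time_avg_def[abs_def] L2_norm_def)
  qed
  have conserved: "discrete_energy D ?a \<Delta>t u (Suc k) = discrete_energy D ?a \<Delta>t u k" for k
  proof -
    have "?m (\<lambda>x. (u (Suc (Suc k)) x - 2 *\<^sub>R u (Suc k) x + u k x) /\<^sub>R \<Delta>t\<^sup>2) w = - ?a (u (Suc k)) w"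
      if w: "w \<in> Vh" for w
    proof -
      have *: "\<forall>k\<ge>1. \<forall>w\<in>Vh. ?m (\<lambda>x. (u (k + 1) x - 2 *\<^sub>R u k x + u (k - 1) x) /\<^sub>R \<Delta>t\<^sup>2) w =
          ?m (force \<epsilon> J \<omega> f g (u k)) w + ?m (bh k) w"
        using scheme unfolding central_difference_scheme_def by (rule conjunct1)
      have "?m (\<lambda>x. (u (Suc (Suc k)) x - 2 *\<^sub>R u (Suc k) x + u k x) /\<^sub>R \<Delta>t\<^sup>2) w =
          ?m (force \<epsilon> J \<omega> f g (u (Suc k))) w + ?m (bh (Suc k)) w"
        using *[rule_format, of "Suc k" w] w by simp
      also have "\<dots> = - ?a (u (Suc k)) w"
        using no_load[OF w] force_weak_form[OF subsetD[OF lip u_in] subsetD[OF lip w]] by simp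
      finally show ?thesis .
    qed
    then show ?thesis
      using leapfrog_energy_step[where p = "u k" and q = "u (Suc k)" and r = "u (Suc (Suc k))"
          and \<tau> = \<Delta>t, OF V m a u_in u_in u_in] step
      unfolding energy by simp
  qed
  have nonneg: "0 \<le> discrete_energy D ?a \<Delta>t u k" for k
  proof -
    have CFL': "\<Delta>t\<^sup>2 / 4 * ?a w w \<le> ?m w w" if w: "w \<in> Vh" for w
    \<comment> \<open>The supremum omits \<open>w = 0\<close>, for which both forms vanish by bilinearity.\<close>
    proof (cases "w = (\<lambda>_. 0)")
      case True
      have "B w w = 0" if "symmetric_bilinear_on Vh B" for B
      proof -
        have "B (\<lambda>x. 0 *\<^sub>R w x + 0 *\<^sub>R w x) w = 0 * B w w + 0 * B w w"
          using that w unfolding symmetric_bilinear_on_def by meson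
        then show ?thesis by (simp add: True)
      qed
      from this[OF m] this[OF a] show ?thesis by simp
    next
      case False
      have "0 < ?m w w"
        using w lip Vh by (intro L2_inner_pos False) (auto simp: fe_space_def)
      with CFL_bound[OF CFL _ w False] step show ?thesis by simp
    qed
    have "(\<lambda>x. (u (Suc k) x - u k x) /\<^sub>R \<Delta>t) =
        (\<lambda>x. (1 / \<Delta>t) *\<^sub>R u (Suc k) x + (- 1 / \<Delta>t) *\<^sub>R u k x)"
      by (simp add: fun_eq_iff scaleR_diff_right inverse_eq_divide)
    moreover have "(\<lambda>x. (1 / \<Delta>t) *\<^sub>R u (Suc k) x + (- 1 / \<Delta>t) *\<^sub>R u k x) \<in> Vh"
      using V[unfolded function_subspace_def, THEN bspec, THEN bspec, THEN spec, THEN spec,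
          of "u (Suc k)" "u k" "1 / \<Delta>t" "- 1 / \<Delta>t"] u_in by simp
    ultimately have "(\<lambda>x. (u (Suc k) x - u k x) /\<^sub>R \<Delta>t) \<in> Vh" by simp
    from CFL'[OF this] bilin_nonneg[OF potentials[THEN potential_second_derivative_nonneg]]
    show ?thesis unfolding energy by (simp add: add_nonneg_nonneg)
  qed
  have "discrete_energy D ?a \<Delta>t u k = discrete_energy D ?a \<Delta>t u 0" for k
    by (induction k) (simp_all add: conserved)
  with nonneg show ?thesis by blast
qed

end
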